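(* Let $k\ge2$ be a fixed integer and let $(\alpha_l)_{l\ge0}$, $(\gamma_l)_{l\ge0}$ be real sequences with $\alpha_l>-1/2$, $\gamma_l>-1$, $\lim_{l\to\infty}\frac{\alpha_l}{l}=a\ge 0$ and $\lim_{l\to\infty}\frac{\gamma_l}{l}=c\ge0$. For $l\ge1$ put $\alpha_l^*=\alpha_{\lfloor (l-1)/k\rfloor}$, $\gamma_l^*=\gamma_{\lfloor (l-1)/k\rfloor}$, and for $y\in[-1,1]$ let $$N_l^{(\alpha_l^*,\gamma_l^* )}(y)=\#\{x\le y \mid C_l^{(\alpha_l^*,\gamma_l^* )}(x,k)=0\}$$ be the number of zeros less than or equal to $y$ of the generalized sieved ultraspherical polynomial of the first kind $C_l^{(\alpha_l^*,\gamma_l^* )}(x,k)$. Then for every $y\in[-1,1]$ $$\lim_{l\to\infty}\frac1l N_l^{(\alpha_l^*,\gamma_l^* )}(y)=\frac{2a+c+2}{2\pi}\int_{-1}^{y}\frac{\sqrt{4\mu_{a,c}-(T_k^2(x)-\kappa_{a,c})^2}}{|U_{k-1}(x)|\,|T_k(x)|\,(1-x^2)}\,I\{x\in\overline{E_k(\kappa_{a,c},\mu_{a,c})}\}\,dx,$$ where $$\mu_{a,c}=\frac{(2a+1)(c+1)(2a+c+1)}{(2a+c+2)^4},\qquad \kappa_{a,c}=\frac{(2a+1)(c+2)+c(c+1)}{(2a+c+2)^2}.$$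
   Context: $T_k$, $U_{k-1}$ are the Chebyshev polynomials of the first and second kind, $I$ denotes the indicator function, $\lfloor\cdot\rfloor$ the floor function, and $\overline{E_k(\kappa,\mu)}$ is the closure of $E_k(\kappa,\mu)=\{x\in[-1,1] : |T_k^2(x)-\kappa|^2<4\mu\}$. For $\alpha>-1/2$, $\gamma>-1$ the generalized sieved ultraspherical polynomials of the first kind $C_n^{(\alpha,\gamma)}(x,k)$ are the orthogonal polynomials on $[-1,1]$ with respect to $(1-x^2)^{\alpha-1/2}|U_{k-1}(x)|^{2\alpha}|T_k(x)|^{\gamma}dx$, defined by $C_0^{(\alpha,\gamma)}(x,k)=1$, $C_1^{(\alpha,\gamma)}(x,k)=x$ and, writing $C_j=C_j^{(\alpha,\gamma)}(x,k)$, for $n,j\ge1$: $(2\alpha+\gamma+2n)xC_{nk}=(2\alpha+\gamma+n)C_{nk+1}+nC_{nk-1}$ if $n$ is even; $(2\alpha+\gamma+2n)xC_{nk}=(2\alpha+n)C_{nk+1}+(n+\gamma)C_{nk-1}$ if $n$ is odd; $2xC_j=C_{j+1}+C_{j-1}$ if $k\nmid j$. *)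

theory Defs
  imports "HOL-Analysis.Analysis" "HOL-Computational_Algebra.Polynomial"
begin

fun cheb_T :: "nat \<Rightarrow> real poly" where
  "cheb_T 0 = 1"
| "cheb_T (Suc 0) = [:0, 1:]"
| "cheb_T (Suc (Suc n)) = [:0, 2:] * cheb_T (Suc n) - cheb_T n"

fun cheb_U :: "nat \<Rightarrow> real poly" where
  "cheb_U 0 = 1"
| "cheb_U (Suc 0) = [:0, 2:]"
| "cheb_U (Suc (Suc n)) = [:0, 2:] * cheb_U (Suc n) - cheb_U n"

lemma poly_cheb_T_cos: "poly (cheb_T n) (cos t) = cos (real n * t)"
proof (induction n rule: cheb_T.induct)
  case (3 n)
  have "cos (real (Suc (Suc n)) * t) = cos (real (Suc n) * t + t)"
    and "cos (real n * t) = cos (real (Suc n) * t - t)"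
    by (simp_all add: algebra_simps)
  then have "cos (real (Suc (Suc n)) * t)
      = 2 * cos t * cos (real (Suc n) * t) - cos (real n * t)"
    unfolding cos_add cos_diff by simp
  then show ?case using 3 by simp
qed simp_all

lemma poly_cheb_U_cos: "sin t * poly (cheb_U n) (cos t) = sin (real (Suc n) * t)"
proof (induction n rule: cheb_U.induct)
  case 2
  then show ?case using sin_double[of t] by simp
next
  case (3 n)
  have "sin (real (Suc (Suc (Suc n))) * t) = sin (real (Suc (Suc n)) * t + t)"
    and "sin (real (Suc n) * t) = sin (real (Suc (Suc n)) * t - t)"
    by (simp_all add: algebra_simps)
  then have "sin (real (Suc (Suc (Suc n))) * t)
      = 2 * cos t * sin (real (Suc (Suc n)) * t) - sin (real (Suc n) * t)"
    unfolding sin_add sin_diff by simp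
  moreover have "sin t * poly (cheb_U (Suc (Suc n))) (cos t)
      = 2 * cos t * (sin t * poly (cheb_U (Suc n)) (cos t)) - sin t * poly (cheb_U n) (cos t)"
    by (simp add: algebra_simps)
  ultimately show ?case using 3 by simp
qed simp

text \<open>
  The polynomial \<open>sieved_C k \<alpha> \<gamma> j\<close> is \<open>C\<^sub>j\<close> for the parameters \<open>(\<alpha>, \<gamma>)\<close>. The three-term
  recurrences are solved for the polynomial of highest index; they are restated in their usual
  form in the lemmas below. The divisors are positive when \<open>\<alpha> > -1/2\<close> and \<open>\<gamma> > -1\<close>.
\<close>

fun sieved_C :: "nat \<Rightarrow> real \<Rightarrow> real \<Rightarrow> nat \<Rightarrow> real poly" where
  "sieved_C k \<alpha> \<gamma> 0 = 1"
| "sieved_C k \<alpha> \<gamma> (Suc 0) = [:0, 1:]"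
| "sieved_C k \<alpha> \<gamma> (Suc (Suc i)) =
    (let n = Suc i div k in
     if \<not> k dvd Suc i then
       [:0, 2:] * sieved_C k \<alpha> \<gamma> (Suc i) - sieved_C k \<alpha> \<gamma> i
     else if even n then
       smult (1 / (2 * \<alpha> + \<gamma> + real n))
         ([:0, 2 * \<alpha> + \<gamma> + 2 * real n:] * sieved_C k \<alpha> \<gamma> (Suc i)
           - smult (real n) (sieved_C k \<alpha> \<gamma> i))
     else
       smult (1 / (2 * \<alpha> + real n))
         ([:0, 2 * \<alpha> + \<gamma> + 2 * real n:] * sieved_C k \<alpha> \<gamma> (Suc i)
           - smult (real n + \<gamma>) (sieved_C k \<alpha> \<gamma> i)))"

lemma sieved_C_recurrence_even:
  fixes \<alpha> \<gamma> x :: real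
  assumes "k \<ge> 1" "\<alpha> > -1/2" "\<gamma> > -1" "n \<ge> 1" "even n"
  shows "(2 * \<alpha> + \<gamma> + 2 * real n) * x * poly (sieved_C k \<alpha> \<gamma> (n * k)) x
    = (2 * \<alpha> + \<gamma> + real n) * poly (sieved_C k \<alpha> \<gamma> (n * k + 1)) x
      + real n * poly (sieved_C k \<alpha> \<gamma> (n * k - 1)) x"
proof -
  obtain i where i: "n * k = Suc i"
    using assms by (metis One_nat_def Suc_le_D mult_le_mono nat_mult_1_right)
  have d: "Suc i div k = n" "k dvd Suc i"
    unfolding i[symmetric] using assms by auto
  have "n \<ge> 2" using assms by (cases "n = 1") auto
  then have "2 * \<alpha> + \<gamma> + real n > 0" using assms by linarith
  then have "(2 * \<alpha> + \<gamma> + real n) * poly (sieved_C k \<alpha> \<gamma> (Suc (Suc i))) x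
      = x * (2 * \<alpha> + \<gamma> + 2 * real n) * poly (sieved_C k \<alpha> \<gamma> (Suc i)) x
        - real n * poly (sieved_C k \<alpha> \<gamma> i) x"
    using d assms by simp
  then show ?thesis unfolding i by (simp del: sieved_C.simps add: mult.commute)
qed

lemma sieved_C_recurrence_odd:
  fixes \<alpha> \<gamma> x :: real
  assumes "k \<ge> 1" "\<alpha> > -1/2" "n \<ge> 1" "odd n"
  shows "(2 * \<alpha> + \<gamma> + 2 * real n) * x * poly (sieved_C k \<alpha> \<gamma> (n * k)) x
    = (2 * \<alpha> + real n) * poly (sieved_C k \<alpha> \<gamma> (n * k + 1)) x
      + (real n + \<gamma>) * poly (sieved_C k \<alpha> \<gamma> (n * k - 1)) x"
proof -
  obtain i where i: "n * k = Suc i"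
    using assms by (metis One_nat_def Suc_le_D mult_le_mono nat_mult_1_right)
  have d: "Suc i div k = n" "k dvd Suc i"
    unfolding i[symmetric] using assms by auto
  have "2 * \<alpha> + real n > 0" using assms by linarith
  then have "(2 * \<alpha> + real n) * poly (sieved_C k \<alpha> \<gamma> (Suc (Suc i))) x
      = x * (2 * \<alpha> + \<gamma> + 2 * real n) * poly (sieved_C k \<alpha> \<gamma> (Suc i)) x
        - (real n + \<gamma>) * poly (sieved_C k \<alpha> \<gamma> i) x"
    using d assms by simp
  then show ?thesis unfolding i by (simp del: sieved_C.simps add: mult.commute)
qed

lemma sieved_C_recurrence_not_dvd:
  assumes "j \<ge> 1" "\<not> k dvd j"
  shows "2 * x * poly (sieved_C k \<alpha> \<gamma> j) x
    = poly (sieved_C k \<alpha> \<gamma> (j + 1)) x + poly (sieved_C k \<alpha> \<gamma> (j - 1)) x"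
  using assms by (cases j) (simp_all add: algebra_simps)

definition zero_count :: "nat \<Rightarrow> real \<Rightarrow> real \<Rightarrow> nat \<Rightarrow> real \<Rightarrow> nat" where
  "zero_count k \<alpha> \<gamma> l y = card {x. x \<le> y \<and> poly (sieved_C k \<alpha> \<gamma> l) x = 0}"

text \<open>Only the values for \<open>l \<ge> 1\<close> are meaningful (truncated subtraction).\<close>

definition star :: "nat \<Rightarrow> (nat \<Rightarrow> real) \<Rightarrow> nat \<Rightarrow> real" where
  "star k s l = s ((l - 1) div k)"

definition E_set :: "nat \<Rightarrow> real \<Rightarrow> real \<Rightarrow> real set" where
  "E_set k \<kappa> \<mu> = {x \<in> {-1..1}. \<bar>(poly (cheb_T k) x)\<^sup>2 - \<kappa>\<bar>\<^sup>2 < 4 * \<mu>}"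

definition mu_ac :: "real \<Rightarrow> real \<Rightarrow> real" where
  "mu_ac a c = (2 * a + 1) * (c + 1) * (2 * a + c + 1) / (2 * a + c + 2) ^ 4"

definition kappa_ac :: "real \<Rightarrow> real \<Rightarrow> real" where
  "kappa_ac a c = ((2 * a + 1) * (c + 2) + c * (c + 1)) / (2 * a + c + 2)\<^sup>2"

end

theory Submission imports Defs begin

text \<open>
  Consecutive polynomials have a positive Wronskian, so their zeros interlace and the zero count
  changes by at most one when the degree does; hence the degree may be replaced by an even multiple
  \<open>M k\<close> of \<open>k\<close>. There \<open>C\<^bsub>M k\<^esub>(cos \<theta>) = P\<^sub>M(cos k\<theta>)\<close> for the generalized Gegenbauer polynomial
  \<open>P\<^sub>M\<close>, and \<open>|sin k\<theta>|\<^sup>\<alpha> |cos k\<theta>|\<^bsup>\<gamma>/2\<^esup> P\<^sub>M(cos k\<theta>)\<close> solves \<open>w'' + F w = 0\<close> with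
  \<open>F = k\<^sup>2 ((M + \<alpha> + \<gamma>/2)\<^sup>2 + (\<alpha> - \<alpha>\<^sup>2)/sin\<^sup>2 k\<theta> + (\<gamma>/2 - \<gamma>\<^sup>2/4)/cos\<^sup>2 k\<theta>)\<close>. Since \<open>F / n\<^sup>2\<close>
  converges to an explicit \<open>f\<close>, Sturm comparison shows that the zeros have local density
  \<open>n sqrt(max f 0) / pi\<close> away from the singular points, while near a singular point comparison with
  the critical inverse square potential keeps their number of order \<open>n\<close> times the length. The
  substitution \<open>x = cos \<theta>\<close> turns the integral of the density into the stated one.
\<close>

section \<open>Interlacing and reduction to generalized Gegenbauer polynomials\<close>

text \<open>The parameters vary with the degree, so the counted polynomials are not one orthogonal
  sequence. They are constant, however, for \<open>n * k < l \<le> n * k + k\<close>, and some even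
  multiple of \<open>k\<close> lies within distance \<open>k\<close> of \<open>l\<close>;
  interlacing at fixed parameters then costs only a bounded number of zeros. The obstacle is the
  behaviour at the singular points. There \<open>\<alpha> - \<alpha>^2\<close> may be positive, so
  \<open>F\<close> can be unbounded above and comparison with a sine fails. What helps is that this
  coefficient and \<open>\<gamma> / 2 - \<gamma>^2 / 4\<close> never exceed 1/4, the largest
  coefficient for which an inverse square potential still has a positive solution, namely
  \<open>sqrt x\<close>. In the variable \<open>u = cos^2 (k \<theta>)\<close> the limit potential
  is a quadratic polynomial divided by \<open>u * (1 - u)\<close>. Completing the square in the
  numerator produces \<open>kappa_ac\<close> and \<open>mu_ac\<close>; its roots
  \<open>kappa_ac \<plusminus> 2 sqrt mu_ac\<close> are the turning points of the equation.\<close>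

declare sieved_C.simps(3) [simp del]

text \<open>Brings the three cases to one shape. The relation \<open>A - B = 1\<close> reflects the
  common value 1 at the point 1; with positivity of \<open>A\<close> and \<open>B\<close> it is all
  that the Wronskian and sign arguments use.\<close>

lemma sieved_C_recurrence:
  assumes "k \<ge> 1" "\<alpha> > -1/2" "\<gamma> > -1"
  obtains A B where "A > 0" "B > 0" "A - B = 1"
    "sieved_C k \<alpha> \<gamma> (Suc (Suc i)) = [:0, A:] * sieved_C k \<alpha> \<gamma> (Suc i) - smult B (sieved_C k \<alpha> \<gamma> i)"
proof (cases "k dvd Suc i")
  case False
  then show thesis by (intro that[of 2 1]) (simp_all add: sieved_C.simps(3))
next
  case True
  define n where "n = Suc i div k"
  have "n \<noteq> 0" using True assms(1) by (simp add: n_def dvd_div_eq_0_iff)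
  define D where "D = (if even n then 2 * \<alpha> + \<gamma> + real n else 2 * \<alpha> + real n)"
  define N where "N = (if even n then real n else real n + \<gamma>)"
  \<comment> \<open>The sum \<open>2 * \<alpha> + \<gamma>\<close> can be close to -2, so the
    divisor of the even case is positive only from \<open>n = 2\<close> on.\<close>
  have "even n \<longrightarrow> n \<ge> 2" using \<open>n \<noteq> 0\<close> by (cases "n = 1") auto
  then have pos: "D > 0" "N > 0" using assms \<open>n \<noteq> 0\<close> unfolding D_def N_def by (auto simp: Suc_le_eq)
  have sum: "2 * \<alpha> + \<gamma> + 2 * real n = D + N" unfolding D_def N_def by simp
  have "sieved_C k \<alpha> \<gamma> (Suc (Suc i)) = smult (1 / D) ([:0, D + N:] * sieved_C k \<alpha> \<gamma> (Suc i)
           - smult N (sieved_C k \<alpha> \<gamma> i))"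
    using True unfolding sieved_C.simps(3) Let_def n_def[symmetric] sum D_def N_def by simp
  also have "\<dots> = [:0, (D + N) / D:] * sieved_C k \<alpha> \<gamma> (Suc i) - smult (N / D) (sieved_C k \<alpha> \<gamma> i)"
    by (simp add: smult_diff_right)
  finally show thesis using pos by (intro that[of "(D + N) / D" "N / D"]) (simp_all add: field_simps)
qed

text \<open>The confluent Christoffel-Darboux argument: the recurrence writes each Wronskian as
  \<open>A\<close> times a square plus \<open>B\<close> times the preceding Wronskian.\<close>

lemma sieved_C_wronskian_pos:
  assumes "k \<ge> 1" "\<alpha> > -1/2" "\<gamma> > -1"
  shows "poly (pderiv (sieved_C k \<alpha> \<gamma> (Suc j))) x * poly (sieved_C k \<alpha> \<gamma> j) x
    - poly (sieved_C k \<alpha> \<gamma> (Suc j)) x * poly (pderiv (sieved_C k \<alpha> \<gamma> j)) x > 0"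
proof (induction j)
  case 0
  show ?case by (simp add: pderiv_pCons)
next
  case (Suc j)
  obtain A B where AB: "A > 0" "B > 0" "A - B = 1"
    "sieved_C k \<alpha> \<gamma> (Suc (Suc j)) = [:0, A:] * sieved_C k \<alpha> \<gamma> (Suc j) - smult B (sieved_C k \<alpha> \<gamma> j)"
    using sieved_C_recurrence[OF assms] .
  let ?p = "sieved_C k \<alpha> \<gamma> (Suc j)" and ?q = "sieved_C k \<alpha> \<gamma> j"
  have "poly (pderiv (sieved_C k \<alpha> \<gamma> (Suc (Suc j)))) x * poly ?p x
      - poly (sieved_C k \<alpha> \<gamma> (Suc (Suc j))) x * poly (pderiv ?p) x
    = A * (poly ?p x)\<^sup>2 + B * (poly (pderiv ?p) x * poly ?q x - poly ?p x * poly (pderiv ?q) x)"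
    unfolding AB(4) by (simp add: pderiv_diff pderiv_mult pderiv_smult pderiv_pCons power2_eq_square algebra_simps)
  also have "\<dots> > 0" using AB(1,2) Suc by (simp add: add_nonneg_pos)
  finally show ?case .
qed

text \<open>With alternating signs the values at \<open>x \<le> -1\<close> are positive and
  nondecreasing in the degree: if the last two satisfy \<open>s' \<ge> s\<close>, the next one is at
  least \<open>A * s' - B * s' = s'\<close>. This later allows the end \<open>\<theta> = pi\<close>
  to be left out of the count.\<close>

lemma sieved_C_neg_nonzero:
  assumes "k \<ge> 1" "\<alpha> > -1/2" "\<gamma> > -1" "x \<le> -1"
  shows "poly (sieved_C k \<alpha> \<gamma> j) x \<noteq> 0"
proof -
  let ?s = "\<lambda>j. (-1) ^ j * poly (sieved_C k \<alpha> \<gamma> j) x"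
  have "?s j > 0 \<and> ?s (Suc j) \<ge> ?s j"
  proof (induction j)
    case 0
    then show ?case using assms by simp
  next
    case (Suc j)
    obtain A B where AB: "A > 0" "B > 0" "A - B = 1"
      "sieved_C k \<alpha> \<gamma> (Suc (Suc j)) = [:0, A:] * sieved_C k \<alpha> \<gamma> (Suc j) - smult B (sieved_C k \<alpha> \<gamma> j)"
      using sieved_C_recurrence[OF assms(1-3)] .
    have eq: "?s (Suc (Suc j)) = A * (- x) * ?s (Suc j) - B * ?s j"
      unfolding AB(4) by (simp add: algebra_simps)
    have "?s (Suc j) > 0" using Suc by linarith
    then have "A * ?s (Suc j) * 1 \<le> A * ?s (Suc j) * (- x)"
      using AB(1) assms(4) by (intro mult_left_mono mult_nonneg_nonneg[of A]) linarith+
    moreover have "B * ?s j \<le> B * ?s (Suc j)" using AB Suc by (intro mult_left_mono) auto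
    moreover have "A * ?s (Suc j) = B * ?s (Suc j) + ?s (Suc j)" using AB(3)
      by (metis add.commute diff_add_cancel distrib_right mult_1)
    ultimately have "?s (Suc (Suc j)) \<ge> ?s (Suc j)" unfolding eq
      by (smt (verit) mult.assoc mult.commute)
    then show ?case using \<open>?s (Suc j) > 0\<close> by blast
  qed
  then show ?thesis by auto
qed

lemma sieved_C_nonzero:
  assumes "k \<ge> 1" "\<alpha> > -1/2" "\<gamma> > -1"
  shows "sieved_C k \<alpha> \<gamma> j \<noteq> 0"
  using sieved_C_neg_nonzero[OF assms, of "-1" j] by auto

text \<open>Every element of \<open>A\<close> except the largest is sent to a point of
  \<open>B\<close> before its successor in \<open>A\<close>; these points are distinct.\<close>

lemma card_le_Suc_if_separated:
  fixes A B :: "'a::linorder set"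
  assumes "finite A" "finite B"
    and sep: "\<And>a b. a \<in> A \<Longrightarrow> b \<in> A \<Longrightarrow> a < b \<Longrightarrow> \<exists>c\<in>B. a < c \<and> c < b"
  shows "card A \<le> card B + 1"
proof -
  have "\<exists>c\<in>B. a < c \<and> (\<forall>b\<in>A. a < b \<longrightarrow> c < b)" if a: "a \<in> A - {Max A}" for a
  proof -
    let ?b = "Min {b\<in>A. a < b}"
    have "Max A \<in> {b\<in>A. a < b}" using a assms(1) by (auto intro: Max_in order.not_eq_order_implies_strict)
    then have b: "?b \<in> {b\<in>A. a < b}" using assms(1) by (intro Min_in) auto
    then obtain c where c: "c \<in> B" "a < c" "c < ?b" using sep[of a ?b] a by auto
    moreover have "?b \<le> b" if "b \<in> A" "a < b" for b using that assms(1) by (intro Min_le) auto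
    ultimately show ?thesis by (metis order_less_le_trans)
  qed
  then obtain f where f: "\<And>a. a \<in> A - {Max A} \<Longrightarrow> f a \<in> B \<and> a < f a \<and> (\<forall>b\<in>A. a < b \<longrightarrow> f a < b)"
    by metis
  have "inj_on f (A - {Max A})"
  proof (rule linorder_inj_onI')
    fix a b assume ab: "a \<in> A - {Max A}" "b \<in> A - {Max A}" "a < b"
    then have "f a < b" "b < f b" using f by auto
    then show "f a \<noteq> f b" by auto
  qed
  then have "card (A - {Max A}) \<le> card B" using f assms(2) by (intro card_inj_on_le) auto
  then show ?thesis using card_Diff1_le[of A "Max A"]
    by (cases "A = {}") (use assms(1) in \<open>auto simp: card_Diff_singleton\<close>)
qed

text \<open>If the Wronskian of \<open>p\<close> and \<open>q\<close> vanishes nowhere, Rolle's theorem for \<open>p / q\<close> puts a zero of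
  \<open>q\<close> between any two zeros of \<open>p\<close>.\<close>

lemma card_roots_wronskian:
  fixes p q :: "real poly"
  assumes W: "\<And>x. poly (pderiv p) x * poly q x - poly p x * poly (pderiv q) x \<noteq> 0"
  shows "card {x. x \<le> y \<and> poly p x = 0} \<le> card {x. x \<le> y \<and> poly q x = 0} + 1"
proof (rule card_le_Suc_if_separated)
  have "p \<noteq> 0" "q \<noteq> 0" using W[of 0] by auto
  then show "finite {x. x \<le> y \<and> poly p x = 0}" "finite {x. x \<le> y \<and> poly q x = 0}"
    using poly_roots_finite by (auto intro: finite_subset[rotated])
  fix a b assume ab: "a \<in> {x. x \<le> y \<and> poly p x = 0}" "b \<in> {x. x \<le> y \<and> poly p x = 0}" "a < b"
  have "\<exists>c. a < c \<and> c < b \<and> poly q c = 0"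
  proof (rule ccontr)
    assume neg: "\<not> ?thesis"
    have nz: "poly q x \<noteq> 0" if "x \<in> {a..b}" for x
    proof (cases "x = a \<or> x = b")
      case True
      then have "poly p x = 0" using ab by auto
      then show ?thesis using W[of x] by auto
    next
      case False
      then show ?thesis using neg that by force
    qed
    have "\<exists>z. a < z \<and> z < b \<and> ((\<lambda>x. poly p x / poly q x) has_real_derivative 0) (at z)"
    proof (rule Rolle)
      show "continuous_on {a..b} (\<lambda>x. poly p x / poly q x)"
        using nz by (intro continuous_intros) auto
      show "(\<lambda>x. poly p x / poly q x) differentiable at x" if "a < x" "x < b" for x
        using nz[of x] that by (intro differentiable_divide) auto
    qed (use ab in auto)
    then obtain z where z: "a < z" "z < b" "((\<lambda>x. poly p x / poly q x) has_real_derivative 0) (at z)" by blast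
    have "poly q z \<noteq> 0" using z nz by auto
    then have "((\<lambda>x. poly p x / poly q x) has_real_derivative
          (poly (pderiv p) z * poly q z - poly p z * poly (pderiv q) z) / (poly q z * poly q z)) (at z)"
      by (intro DERIV_divide poly_DERIV)
    from DERIV_unique[OF this z(3)] show False using W[of z] \<open>poly q z \<noteq> 0\<close> by simp
  qed
  then obtain c where "a < c" "c < b" "poly q c = 0" by blast
  then show "\<exists>c\<in>{x. x \<le> y \<and> poly q x = 0}. a < c \<and> c < b" using ab by (intro bexI[of _ c]) auto
qed

lemma zero_count_Suc:
  assumes "k \<ge> 1" "\<alpha> > -1/2" "\<gamma> > -1"
  shows "\<bar>real (zero_count k \<alpha> \<gamma> (Suc l) y) - real (zero_count k \<alpha> \<gamma> l y)\<bar> \<le> 1"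
proof -
  note W = sieved_C_wronskian_pos[OF assms, of l]
  have "card {x. x \<le> y \<and> poly (sieved_C k \<alpha> \<gamma> (Suc l)) x = 0}
      \<le> card {x. x \<le> y \<and> poly (sieved_C k \<alpha> \<gamma> l) x = 0} + 1"
    using W by (intro card_roots_wronskian) (metis less_irrefl)
  moreover have "card {x. x \<le> y \<and> poly (sieved_C k \<alpha> \<gamma> l) x = 0}
      \<le> card {x. x \<le> y \<and> poly (sieved_C k \<alpha> \<gamma> (Suc l)) x = 0} + 1"
    using W by (intro card_roots_wronskian) (smt (verit) mult.commute)
  ultimately show ?thesis unfolding zero_count_def by linarith
qed

lemma zero_count_diff:
  assumes "k \<ge> 1" "\<alpha> > -1/2" "\<gamma> > -1"
  shows "\<bar>real (zero_count k \<alpha> \<gamma> (l + j) y) - real (zero_count k \<alpha> \<gamma> l y)\<bar> \<le> real j"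
proof (induction j)
  case (Suc j)
  then show ?case using zero_count_Suc[OF assms, of "l + j" y] by simp
qed simp

text \<open>The general solution of the Chebyshev recurrence. It is demanded only for
  \<open>0 < i < k\<close> because the sieved recurrence changes at multiples of \<open>k\<close>;
  it is used from such a multiple upwards and, with reversed indices, downwards.\<close>

lemma chebyshev_recurrence_sin:
  fixes g :: "nat \<Rightarrow> real"
  assumes "\<And>i. 0 < i \<Longrightarrow> i < k \<Longrightarrow> g (i + 1) = 2 * cos \<theta> * g i - g (i - 1)" and "j \<le> k"
  shows "sin \<theta> * g j = sin (real j * \<theta>) * g 1 - sin ((real j - 1) * \<theta>) * g 0"
  using assms(2)
proof (induction j rule: cheb_T.induct)
  case (3 n)
  have "sin (real (Suc (Suc n)) * \<theta>) = 2 * cos \<theta> * sin (real (Suc n) * \<theta>) - sin (real n * \<theta>)" for n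
    using sin_add[of "real (Suc n) * \<theta>" \<theta>] sin_diff[of "real (Suc n) * \<theta>" \<theta>] by (simp add: algebra_simps)
  note s = this
  have s': "sin ((real (Suc (Suc n)) - 1) * \<theta>) = 2 * cos \<theta> * sin ((real (Suc n) - 1) * \<theta>) - sin ((real n - 1) * \<theta>)"
    using sin_add[of "real n * \<theta>" \<theta>] sin_diff[of "real n * \<theta>" \<theta>] by (simp add: algebra_simps)
  have "sin \<theta> * g (Suc (Suc n)) = 2 * cos \<theta> * (sin \<theta> * g (Suc n)) - sin \<theta> * g n"
    using assms(1)[of "Suc n"] 3(3) by (simp add: right_diff_distrib)
  also have "\<dots> = sin (real (Suc (Suc n)) * \<theta>) * g 1 - sin ((real (Suc (Suc n)) - 1) * \<theta>) * g 0"
  proof -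
    have "sin \<theta> * g (Suc n) = sin (real (Suc n) * \<theta>) * g 1 - sin ((real (Suc n) - 1) * \<theta>) * g 0"
      "sin \<theta> * g n = sin (real n * \<theta>) * g 1 - sin ((real n - 1) * \<theta>) * g 0"
      using 3 by simp_all
    then show ?thesis unfolding s s' by algebra
  qed
  finally show ?case .
qed simp_all

text \<open>The recurrence of \<open>sieved_C 1\<close> is the one of the generalized Gegenbauer polynomials, normalized
  to take the value \<open>1\<close> at \<open>1\<close>.\<close>

lemma sieved_C_eq_gegenbauer:
  assumes "k \<ge> 1" "\<alpha> > -1/2" "\<gamma> > -1" "sin \<theta> \<noteq> 0"
  shows "poly (sieved_C k \<alpha> \<gamma> (n * k)) (cos \<theta>) = poly (sieved_C 1 \<alpha> \<gamma> n) (cos (real k * \<theta>))"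
proof (induction n rule: cheb_T.induct)
  case 1
  then show ?case by simp
next
  case 2
  have "poly (sieved_C k \<alpha> \<gamma> j) (cos \<theta>) = cos (real j * \<theta>)" if "j \<le> k" for j
    using that
  proof (induction j rule: cheb_T.induct)
    case (3 n)
    have "poly (sieved_C k \<alpha> \<gamma> (Suc (Suc n))) (cos \<theta>) = 2 * cos \<theta> * cos (real (Suc n) * \<theta>) - cos (real n * \<theta>)"
      using sieved_C_recurrence_not_dvd[of "Suc n" k "cos \<theta>" \<alpha> \<gamma>] 3 nat_dvd_not_less[of "Suc n" k] by simp
    also have "\<dots> = cos (real (Suc (Suc n)) * \<theta>)"
      using cos_add[of "real (Suc n) * \<theta>" \<theta>] cos_diff[of "real (Suc n) * \<theta>" \<theta>] by (simp add: algebra_simps)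
    finally show ?case .
  qed simp_all
  then show ?case by simp
next
  case (3 n)
  let ?C = "\<lambda>j. poly (sieved_C k \<alpha> \<gamma> j) (cos \<theta>)" and ?m = "Suc n * k"
  let ?R = "\<lambda>j. poly (sieved_C 1 \<alpha> \<gamma> j) (cos (real k * \<theta>))"
  have rec: "?C (j + 1) = 2 * cos \<theta> * ?C j - ?C (j - 1)" if "\<not> k dvd j" for j
    using sieved_C_recurrence_not_dvd[of j k "cos \<theta>" \<alpha> \<gamma>] that by (cases j) auto
  have up: "sin \<theta> * ?C (?m + k) = sin (real k * \<theta>) * ?C (?m + 1) - sin ((real k - 1) * \<theta>) * ?C (?m + 0)"
  proof (rule chebyshev_recurrence_sin[of k "\<lambda>j. ?C (?m + j)"])
    fix i assume i: "0 < i" "i < k"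
    have "\<not> k dvd ?m + i" using i by (metis dvd_add_right_iff dvd_triv_right nat_dvd_not_less)
    from rec[OF this] show "?C (?m + (i + 1)) = 2 * cos \<theta> * ?C (?m + i) - ?C (?m + (i - 1))"
      using i by (simp add: add.assoc mult_Suc)
  qed simp
  have down: "sin \<theta> * ?C (?m - k) = sin (real k * \<theta>) * ?C (?m - 1) - sin ((real k - 1) * \<theta>) * ?C (?m - 0)"
  proof (rule chebyshev_recurrence_sin[of k "\<lambda>j. ?C (?m - j)"])
    fix i assume i: "0 < i" "i < k"
    have eq: "?m - i + i = ?m" using i by (simp add: trans_le_add1)
    have "\<not> k dvd ?m - i" using i eq by (metis dvd_add_right_iff dvd_triv_right nat_dvd_not_less)
    note rec[OF this]
    moreover have "?m - i + 1 = ?m - (i - 1)" "?m - i - 1 = ?m - (i + 1)" using i eq by auto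
    ultimately show "?C (?m - (i + 1)) = 2 * cos \<theta> * ?C (?m - i) - ?C (?m - (i - 1))"
      by simp
  qed simp
  define a b where "a = (if even (Suc n) then 2 * \<alpha> + \<gamma> + real (Suc n) else 2 * \<alpha> + real (Suc n))"
    and "b = (if even (Suc n) then real (Suc n) else real (Suc n) + \<gamma>)"
  have "a > 0" using assms unfolding a_def by (cases n) auto
  have recC: "(a + b) * cos \<theta> * ?C ?m = a * ?C (?m + 1) + b * ?C (?m - 1)"
    using sieved_C_recurrence_even[of k \<alpha> \<gamma> "Suc n" "cos \<theta>"] sieved_C_recurrence_odd[of k \<alpha> "Suc n" \<gamma> "cos \<theta>"] assms
    unfolding a_def b_def by (auto simp: algebra_simps simp del: mult_Suc)
  have recR: "(a + b) * cos (real k * \<theta>) * ?R (Suc n) = a * ?R (Suc (Suc n)) + b * ?R n"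
    using sieved_C_recurrence_even[of 1 \<alpha> \<gamma> "Suc n" "cos (real k * \<theta>)"] sieved_C_recurrence_odd[of 1 \<alpha> "Suc n" \<gamma> "cos (real k * \<theta>)"] assms
    unfolding a_def b_def by (auto simp: algebra_simps)
  \<comment> \<open>The weights \<open>a\<close> and \<open>b\<close> make the two neighbours of
    degree \<open>?m\<close> appear exactly as in \<open>recC\<close>. Replacing them by
    \<open>?C ?m\<close> leaves the factor \<open>sin k\<theta> cos \<theta> - sin (k - 1)\<theta> =
    cos k\<theta> sin \<theta>\<close>, hence the recurrence of \<open>sieved_C 1\<close> at
    \<open>cos k\<theta>\<close>.\<close>
  have "sin \<theta> * (a * ?C (?m + k) + b * ?C (?m - k)) =
     sin (real k * \<theta>) * (a * ?C (?m + 1) + b * ?C (?m - 1)) - (a + b) * sin ((real k - 1) * \<theta>) * ?C ?m"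
  proof -
    have "sin \<theta> * (a * ?C (?m + k) + b * ?C (?m - k)) = a * (sin \<theta> * ?C (?m + k)) + b * (sin \<theta> * ?C (?m - k))"
      by (simp only: algebra_simps)
    then show ?thesis unfolding up down by (simp add: algebra_simps del: mult_Suc)
  qed
  also have "\<dots> = sin \<theta> * ((a + b) * cos (real k * \<theta>) * ?C ?m)"
  proof -
    have "(real k - 1) * \<theta> = real k * \<theta> - \<theta>" by (simp add: algebra_simps)
    then show ?thesis unfolding recC[symmetric] by (simp add: sin_diff algebra_simps del: mult_Suc)
  qed
  finally have "a * ?C (?m + k) + b * ?C (?m - k) = a * ?R (Suc (Suc n)) + b * ?R n"
    using assms(4) recR 3 by (simp del: mult_Suc)
  moreover have "?m - k = n * k" "?m + k = Suc (Suc n) * k" by auto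
  ultimately show ?case using \<open>a > 0\<close> 3 by (simp del: mult_Suc)
qed

section \<open>The differential equation\<close>

text \<open>Structure relations: the derivative in terms of the polynomial and its lower neighbour.
  The factor \<open>|t|^\<gamma>\<close> of the weight makes them depend on the parity, and each one
  enters the proof of the next, so a single induction carries both. They are the source of the
  differential equation.\<close>

lemma gegenbauer_derivative:
  fixes \<alpha> \<gamma> t :: real
  defines "R \<equiv> \<lambda>n. poly (sieved_C 1 \<alpha> \<gamma> n) t"
    and "D \<equiv> \<lambda>n. poly (pderiv (sieved_C 1 \<alpha> \<gamma> n)) t"
  assumes "\<alpha> > -1/2" "\<gamma> > -1"
  shows gegenbauer_derivative_even: "(1 - t\<^sup>2) * D (2 * m) = 2 * real m * (R (2 * m - 1) - t * R (2 * m))" (is "?E m")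
    and gegenbauer_derivative_odd: "t * (1 - t\<^sup>2) * D (2 * m + 1)
      = (2 * real m + 1 + \<gamma>) * t * R (2 * m) - ((2 * real m + 1) * t\<^sup>2 + \<gamma>) * R (2 * m + 1)" (is "?O m")
proof -
  have evR: "(2 * \<alpha> + \<gamma> + 2 * real n) * t * R n = (2 * \<alpha> + \<gamma> + real n) * R (n + 1) + real n * R (n - 1)" if "even n" for n
    using sieved_C_recurrence_even[of 1 \<alpha> \<gamma> n t] assms(3,4) that
    by (cases "n = 0") (simp_all add: R_def)
  have odR: "(2 * \<alpha> + \<gamma> + 2 * real n) * t * R n = (2 * \<alpha> + real n) * R (n + 1) + (real n + \<gamma>) * R (n - 1)" if "odd n" for n
    using sieved_C_recurrence_odd[of 1 \<alpha> n \<gamma> t] assms(3,4) that odd_pos[of n] by (simp add: R_def)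
  have evD: "(2 * \<alpha> + \<gamma> + real n) * D (n + 1) = (2 * \<alpha> + \<gamma> + 2 * real n) * (R n + t * D n) - real n * D (n - 1)"
    if n: "even n" "n \<ge> 2" for n
  proof -
    obtain i where i: "n = Suc i" using n by (cases n) auto
    have "2 * \<alpha> + \<gamma> + real n > 0" using assms n by linarith
    have "smult (2 * \<alpha> + \<gamma> + real n) (sieved_C 1 \<alpha> \<gamma> (Suc (Suc i))) =
        [:0, 2 * \<alpha> + \<gamma> + 2 * real n:] * sieved_C 1 \<alpha> \<gamma> (Suc i) - smult (real n) (sieved_C 1 \<alpha> \<gamma> i)"
      using n \<open>2 * \<alpha> + \<gamma> + real n > 0\<close> by (simp add: sieved_C.simps(3) i)
    from arg_cong[OF this, of "\<lambda>q. poly (pderiv q) t"] show ?thesis unfolding D_def R_def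
      by (simp add: i pderiv_smult pderiv_diff pderiv_mult pderiv_pCons algebra_simps)
  qed
  have odD: "(2 * \<alpha> + real n) * D (n + 1) = (2 * \<alpha> + \<gamma> + 2 * real n) * (R n + t * D n) - (real n + \<gamma>) * D (n - 1)"
    if n: "odd n" for n
  proof -
    obtain i where i: "n = Suc i" using n by (cases n) auto
    have "2 * \<alpha> + real n > 0" using assms i by simp
    have "smult (2 * \<alpha> + real n) (sieved_C 1 \<alpha> \<gamma> (Suc (Suc i))) =
        [:0, 2 * \<alpha> + \<gamma> + 2 * real n:] * sieved_C 1 \<alpha> \<gamma> (Suc i) - smult (real n + \<gamma>) (sieved_C 1 \<alpha> \<gamma> i)"
      using n \<open>2 * \<alpha> + real n > 0\<close> by (simp add: sieved_C.simps(3) i)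
    from arg_cong[OF this, of "\<lambda>q. poly (pderiv q) t"] show ?thesis unfolding D_def R_def
      by (simp add: i pderiv_smult pderiv_diff pderiv_mult pderiv_pCons algebra_simps)
  qed
  have "?E m \<and> ?O m"
  proof (induction m)
    \<comment> \<open>Here the index \<open>2 * m - 1\<close> is truncated to 0, which is harmless
      because its factor \<open>2 * real m\<close> vanishes.\<close>
    case 0
    show ?case by (simp add: R_def D_def pderiv_pCons power2_eq_square algebra_simps)
  next
    case (Suc m)
    define u where "u = real m"
    have n1: "2 * Suc m = 2 * m + 2" "2 * (m + 1) + 1 = 2 * m + 3" "2 * m + 2 - 1 = 2 * m + 1" by auto
    have r: "real (Suc m) = u + 1" "real (2 * m) = 2 * u" "real (2 * m + 1) = 2 * u + 1" "real (2 * m + 2) = 2 * u + 2" by (simp_all add: u_def)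
    have E0: "(1 - t\<^sup>2) * D (2 * m) = 2 * u * (R (2 * m - 1) - t * R (2 * m))"
      and O0: "t * (1 - t\<^sup>2) * D (2 * m + 1) = (2 * u + 1 + \<gamma>) * t * R (2 * m) - ((2 * u + 1) * t\<^sup>2 + \<gamma>) * R (2 * m + 1)"
      using Suc by (simp_all add: u_def)
    have R0: "(2 * \<alpha> + \<gamma> + 4 * u) * t * R (2 * m) = (2 * \<alpha> + \<gamma> + 2 * u) * R (2 * m + 1) + 2 * u * R (2 * m - 1)"
      using evR[of "2 * m"] by (simp add: u_def)
    have R1: "(2 * \<alpha> + \<gamma> + 4 * u + 2) * t * R (2 * m + 1) = (2 * \<alpha> + 2 * u + 1) * R (2 * m + 2) + (2 * u + 1 + \<gamma>) * R (2 * m)"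
      using odR[of "2 * m + 1"] by (simp add: u_def algebra_simps)
    have R2: "(2 * \<alpha> + \<gamma> + 4 * u + 4) * t * R (2 * m + 2) = (2 * \<alpha> + \<gamma> + 2 * u + 2) * R (2 * m + 3) + (2 * u + 2) * R (2 * m + 1)"
      using evR[of "2 * m + 2"] by (simp add: u_def algebra_simps numeral_3_eq_3)
    have D1: "(2 * \<alpha> + 2 * u + 1) * D (2 * m + 2) = (2 * \<alpha> + \<gamma> + 4 * u + 2) * (R (2 * m + 1) + t * D (2 * m + 1)) - (2 * u + 1 + \<gamma>) * D (2 * m)"
      using odD[of "2 * m + 1"] by (simp add: u_def algebra_simps)
    have D2: "(2 * \<alpha> + \<gamma> + 2 * u + 2) * D (2 * m + 3) = (2 * \<alpha> + \<gamma> + 4 * u + 4) * (R (2 * m + 2) + t * D (2 * m + 2)) - (2 * u + 2) * D (2 * m + 1)"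
      using evD[of "2 * m + 2"] by (simp add: u_def algebra_simps numeral_3_eq_3)
    have p1: "2 * \<alpha> + 2 * u + 1 > 0" and p2: "2 * \<alpha> + \<gamma> + 2 * u + 2 > 0" using assms by (auto simp: u_def)
    have "(2 * \<alpha> + 2 * u + 1) * ((1 - t\<^sup>2) * D (2 * m + 2))
        = (2 * \<alpha> + 2 * u + 1) * ((2 * u + 2) * (R (2 * m + 1) - t * R (2 * m + 2)))"
    proof -
      \<comment> \<open>A certificate in free variables: the defect of the wanted equation is a
        polynomial combination of the defects of \<open>D1\<close>, \<open>O0\<close>,
        \<open>E0\<close>, \<open>R0\<close> and \<open>R1\<close>, in this order, and these vanish
        at the actual values. The later eliminations follow the same pattern.\<close>
      have "(2 * \<alpha> + 2 * u + 1) * ((1 - t\<^sup>2) * d2) - (2 * \<alpha> + 2 * u + 1) * ((2 * u + 2) * (r1 - t * r2))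
        = (1 - t\<^sup>2) * ((2 * \<alpha> + 2 * u + 1) * d2 - ((2 * \<alpha> + \<gamma> + 4 * u + 2) * (r1 + t * d1) - (2 * u + 1 + \<gamma>) * d0))
          + (2 * \<alpha> + \<gamma> + 4 * u + 2) * (t * (1 - t\<^sup>2) * d1 - ((2 * u + 1 + \<gamma>) * t * r0 - ((2 * u + 1) * t\<^sup>2 + \<gamma>) * r1))
          - (2 * u + 1 + \<gamma>) * ((1 - t\<^sup>2) * d0 - 2 * u * (r - t * r0))
          + (2 * u + 1 + \<gamma>) * ((2 * \<alpha> + \<gamma> + 4 * u) * t * r0 - ((2 * \<alpha> + \<gamma> + 2 * u) * r1 + 2 * u * r))
          - (2 * u + 2) * t * ((2 * \<alpha> + \<gamma> + 4 * u + 2) * t * r1 - ((2 * \<alpha> + 2 * u + 1) * r2 + (2 * u + 1 + \<gamma>) * r0))"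
        for d0 d1 d2 r r0 r1 r2
        by algebra
      from this[of "D (2 * m + 2)" "R (2 * m + 1)" "R (2 * m + 2)" "D (2 * m + 1)" "D (2 * m)" "R (2 * m)" "R (2 * m - 1)"]
      show ?thesis unfolding E0 O0 R0 R1 D1 by simp
    qed
    then have E1: "(1 - t\<^sup>2) * D (2 * m + 2) = (2 * u + 2) * (R (2 * m + 1) - t * R (2 * m + 2))"
      using p1 by simp
    have "(2 * \<alpha> + \<gamma> + 2 * u + 2) * (t * (1 - t\<^sup>2) * D (2 * m + 3))
      = (2 * \<alpha> + \<gamma> + 2 * u + 2) * ((2 * u + 3 + \<gamma>) * t * R (2 * m + 2) - ((2 * u + 3) * t\<^sup>2 + \<gamma>) * R (2 * m + 3))"
    proof -
      have "(2 * \<alpha> + \<gamma> + 2 * u + 2) * (t * (1 - t\<^sup>2) * d3)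
          - (2 * \<alpha> + \<gamma> + 2 * u + 2) * ((2 * u + 3 + \<gamma>) * t * r2 - ((2 * u + 3) * t\<^sup>2 + \<gamma>) * r3)
        = t * (1 - t\<^sup>2) * ((2 * \<alpha> + \<gamma> + 2 * u + 2) * d3 - ((2 * \<alpha> + \<gamma> + 4 * u + 4) * (r2 + t * d2) - (2 * u + 2) * d1))
          + (2 * \<alpha> + \<gamma> + 4 * u + 4) * t\<^sup>2 * ((1 - t\<^sup>2) * d2 - (2 * u + 2) * (r1 - t * r2))
          - (2 * u + 2) * (t * (1 - t\<^sup>2) * d1 - ((2 * u + 1 + \<gamma>) * t * r0 - ((2 * u + 1) * t\<^sup>2 + \<gamma>) * r1))
          + (2 * u + 2) * t * ((2 * \<alpha> + \<gamma> + 4 * u + 2) * t * r1 - ((2 * \<alpha> + 2 * u + 1) * r2 + (2 * u + 1 + \<gamma>) * r0))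
          - ((2 * u + 3) * t\<^sup>2 + \<gamma>) * ((2 * \<alpha> + \<gamma> + 4 * u + 4) * t * r2 - ((2 * \<alpha> + \<gamma> + 2 * u + 2) * r3 + (2 * u + 2) * r1))"
        for d1 d2 d3 r0 r1 r2 r3
        by algebra
      from this[of "D (2 * m + 3)" "R (2 * m + 2)" "R (2 * m + 3)" "D (2 * m + 2)" "D (2 * m + 1)" "R (2 * m + 1)" "R (2 * m)"]
      show ?thesis unfolding E1 O0 R1 R2 D2 by simp
    qed
    then have O1: "t * (1 - t\<^sup>2) * D (2 * m + 3)
      = (2 * u + 3 + \<gamma>) * t * R (2 * m + 2) - ((2 * u + 3) * t\<^sup>2 + \<gamma>) * R (2 * m + 3)"
      using p2 by simp
    show ?case using E1 O1 by (simp add: u_def numeral_3_eq_3 algebra_simps)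
  qed
  then show "?E m" "?O m" by auto
qed

text \<open>Differentiate the even structure relation, then remove the derivative of the odd
  neighbour by the odd relation and the next lower polynomial by the recurrence; a factor
  \<open>1 - t^2\<close> is cancelled at the end. Odd degrees obey a different equation: for
  \<open>p = t\<close> and \<open>n = 1\<close> the two sides differ by
  \<open>\<gamma>\<close>.\<close>

lemma gegenbauer_ode:
  fixes \<alpha> \<gamma> t :: real
  assumes "\<alpha> > -1/2" "\<gamma> > -1" "1 - t\<^sup>2 \<noteq> 0" "even n"
  defines "p \<equiv> sieved_C 1 \<alpha> \<gamma> n"
  shows "t * (1 - t\<^sup>2) * poly (pderiv (pderiv p)) t
    = ((2 * \<alpha> + \<gamma> + 1) * t\<^sup>2 - \<gamma>) * poly (pderiv p) t - real n * (real n + 2 * \<alpha> + \<gamma>) * t * poly p t"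
proof (cases n)
  case 0
  then show ?thesis by (simp add: p_def)
next
  case (Suc i)
  then have "n = 2 * (n div 2 - 1) + 2" using assms(4) by presburger
  then obtain j where j: "n = 2 * j + 2" by blast
  define q where "q = sieved_C 1 \<alpha> \<gamma> (2 * j + 1)"
  define u where "u = real j"
  have E: "(1 - x\<^sup>2) * poly (pderiv p) x = (2 * u + 2) * (poly q x - x * poly p x)" for x
  proof -
    have idx: "2 * (j + 1) = 2 * j + 2" "2 * j + 2 - 1 = 2 * j + 1" "2 * real (j + 1) = 2 * u + 2"
      by (simp_all add: u_def)
    from gegenbauer_derivative_even[OF assms(1,2), of x "j + 1"] show ?thesis
      unfolding idx p_def q_def j .
  qed
  have "((\<lambda>x. (1 - x\<^sup>2) * poly (pderiv p) x) has_real_derivative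
      (1 - t\<^sup>2) * poly (pderiv (pderiv p)) t - 2 * t * poly (pderiv p) t) (at t)"
    by (auto intro!: derivative_eq_intros simp: algebra_simps)
  moreover have "((\<lambda>x. (2 * u + 2) * (poly q x - x * poly p x)) has_real_derivative
      (2 * u + 2) * (poly (pderiv q) t - poly p t - t * poly (pderiv p) t)) (at t)"
    by (auto intro!: derivative_eq_intros simp: algebra_simps)
  ultimately have E': "(1 - t\<^sup>2) * poly (pderiv (pderiv p)) t - 2 * t * poly (pderiv p) t
      = (2 * u + 2) * (poly (pderiv q) t - poly p t - t * poly (pderiv p) t)"
    unfolding E by (rule DERIV_unique)
  define r where "r = poly (sieved_C 1 \<alpha> \<gamma> (2 * j)) t"
  have O: "t * (1 - t\<^sup>2) * poly (pderiv q) t = (2 * u + 1 + \<gamma>) * t * r - ((2 * u + 1) * t\<^sup>2 + \<gamma>) * poly q t"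
    using gegenbauer_derivative_odd[OF assms(1,2), of t j] by (simp add: q_def r_def u_def)
  have R: "(2 * \<alpha> + \<gamma> + 4 * u + 2) * t * poly q t = (2 * \<alpha> + 2 * u + 1) * poly p t + (2 * u + 1 + \<gamma>) * r"
  proof -
    have idx: "(2 * j + 1) * 1 = 2 * j + 1" "2 * j + 1 + 1 = 2 * j + 2" "2 * j + 1 - 1 = 2 * j"
      "real (2 * j + 1) = 2 * u + 1"
      by (simp_all add: u_def)
    have "(2 * \<alpha> + \<gamma> + 2 * real (2 * j + 1)) * t * poly (sieved_C 1 \<alpha> \<gamma> ((2 * j + 1) * 1)) t
      = (2 * \<alpha> + real (2 * j + 1)) * poly (sieved_C 1 \<alpha> \<gamma> ((2 * j + 1) * 1 + 1)) t
        + (real (2 * j + 1) + \<gamma>) * poly (sieved_C 1 \<alpha> \<gamma> ((2 * j + 1) * 1 - 1)) t"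
      by (rule sieved_C_recurrence_odd) (use assms(1) in auto)
    then show ?thesis unfolding idx p_def q_def r_def j by algebra
  qed
  have "(1 - t\<^sup>2) * (t * (1 - t\<^sup>2) * poly (pderiv (pderiv p)) t) = (1 - t\<^sup>2) *
    (((2 * \<alpha> + \<gamma> + 1) * t\<^sup>2 - \<gamma>) * poly (pderiv p) t - (2 * u + 2) * (2 * u + 2 + 2 * \<alpha> + \<gamma>) * t * poly p t)"
  proof -
    have "(1 - t\<^sup>2) * (t * (1 - t\<^sup>2) * p2)
      - (1 - t\<^sup>2) * (((2 * \<alpha> + \<gamma> + 1) * t\<^sup>2 - \<gamma>) * p1 - (2 * u + 2) * (2 * u + 2 + 2 * \<alpha> + \<gamma>) * t * p0)
      = t * (1 - t\<^sup>2) * ((1 - t\<^sup>2) * p2 - 2 * t * p1 - (2 * u + 2) * (q1 - p0 - t * p1))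
        + (2 * u + 2) * (t * (1 - t\<^sup>2) * q1 - ((2 * u + 1 + \<gamma>) * t * r - ((2 * u + 1) * t\<^sup>2 + \<gamma>) * q0))
        - (2 * u + 2) * t * ((2 * \<alpha> + \<gamma> + 4 * u + 2) * t * q0 - ((2 * \<alpha> + 2 * u + 1) * p0 + (2 * u + 1 + \<gamma>) * r))
        - ((2 * \<alpha> + \<gamma> + 2 * u + 1) * t\<^sup>2 - \<gamma>) * ((1 - t\<^sup>2) * p1 - (2 * u + 2) * (q0 - t * p0))"
      for p0 p1 p2 q0 q1
      by algebra
    from this[of "poly (pderiv (pderiv p)) t" "poly (pderiv p) t" "poly p t" "poly (pderiv q) t" "poly q t"]
    show ?thesis unfolding E E' O R by simp
  qed
  then have "t * (1 - t\<^sup>2) * poly (pderiv (pderiv p)) t = ((2 * \<alpha> + \<gamma> + 1) * t\<^sup>2 - \<gamma>) * poly (pderiv p) t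
      - (2 * u + 2) * (2 * u + 2 + 2 * \<alpha> + \<gamma>) * t * poly p t"
    by (rule mult_left_cancel[OF assms(3), THEN iffD1])
  moreover have "real n = 2 * u + 2" by (simp add: j u_def)
  ultimately show ?thesis by simp
qed

text \<open>The Liouville normal form. Under \<open>x = cos \<theta>\<close> the orthogonality
  measure becomes a multiple of \<open>|sin k\<theta>|^(2 \<alpha>) |cos k\<theta>|^\<gamma>
  d\<theta>\<close>, and multiplying the polynomial by the square root of this weight removes the
  first-order term.\<close>

lemma gegenbauer_liouville:
  fixes \<alpha> \<gamma> \<kappa> :: real and n :: nat
  assumes "\<alpha> > -1/2" "\<gamma> > -1" "even n"
  defines "F \<equiv> \<lambda>\<theta>. \<kappa>\<^sup>2 * ((real n + \<alpha> + \<gamma> / 2)\<^sup>2 + (\<alpha> - \<alpha>\<^sup>2) / (sin (\<kappa> * \<theta>))\<^sup>2 + (\<gamma> / 2 - \<gamma>\<^sup>2 / 4) / (cos (\<kappa> * \<theta>))\<^sup>2)"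
  obtains w w' :: "real \<Rightarrow> real" where
    "\<And>\<theta>. w \<theta> = 0 \<longleftrightarrow> poly (sieved_C 1 \<alpha> \<gamma> n) (cos (\<kappa> * \<theta>)) = 0"
    "\<And>\<theta>. sin (2 * \<kappa> * \<theta>) \<noteq> 0 \<Longrightarrow> (w has_real_derivative w' \<theta>) (at \<theta>)"
    "\<And>\<theta>. sin (2 * \<kappa> * \<theta>) \<noteq> 0 \<Longrightarrow> (w' has_real_derivative - F \<theta> * w \<theta>) (at \<theta>)"
proof
  define p where "p = sieved_C 1 \<alpha> \<gamma> n"
  \<comment> \<open>Logarithms of squares give \<open>|sin|^\<alpha> |cos|^(\<gamma>/2)\<close>
    without cases for the signs. As an exponential, \<open>\<sigma>\<close> is positive even at the
    singular points, so the zeros of \<open>w\<close> are those of the polynomial for every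
    \<open>\<theta>\<close>. The logarithmic derivative of \<open>\<sigma>\<close> is
    \<open>\<kappa> * h\<close>.\<close>
  define \<sigma> where "\<sigma> = (\<lambda>\<theta>. exp (\<alpha> / 2 * ln ((sin (\<kappa> * \<theta>))\<^sup>2) + \<gamma> / 4 * ln ((cos (\<kappa> * \<theta>))\<^sup>2)))"
  define h where "h = (\<lambda>\<theta>. \<alpha> * cos (\<kappa> * \<theta>) / sin (\<kappa> * \<theta>) - \<gamma> / 2 * sin (\<kappa> * \<theta>) / cos (\<kappa> * \<theta>))"
  let ?w = "\<lambda>\<theta>. \<sigma> \<theta> * poly p (cos (\<kappa> * \<theta>))"
  let ?w' = "\<lambda>\<theta>. \<kappa> * \<sigma> \<theta> * (h \<theta> * poly p (cos (\<kappa> * \<theta>)) - sin (\<kappa> * \<theta>) * poly (pderiv p) (cos (\<kappa> * \<theta>)))"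
  show "?w \<theta> = 0 \<longleftrightarrow> poly (sieved_C 1 \<alpha> \<gamma> n) (cos (\<kappa> * \<theta>)) = 0" for \<theta>
    by (simp add: \<sigma>_def p_def)
  fix \<theta> assume "sin (2 * \<kappa> * \<theta>) \<noteq> 0"
  then have nz: "sin (\<kappa> * \<theta>) \<noteq> 0" "cos (\<kappa> * \<theta>) \<noteq> 0"
    using sin_double[of "\<kappa> * \<theta>"] by (auto simp: mult.assoc)
  have d\<sigma>: "(\<sigma> has_real_derivative \<kappa> * \<sigma> \<theta> * h \<theta>) (at \<theta>)"
  proof -
    have pos: "0 < sin (\<kappa> * \<theta>) * sin (\<kappa> * \<theta>)" "0 < cos (\<kappa> * \<theta>) * cos (\<kappa> * \<theta>)"
      using nz by (simp_all add: not_square_less_zero less_le)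
    show ?thesis unfolding \<sigma>_def h_def using nz
      by (auto intro!: derivative_eq_intros simp: field_simps power2_eq_square pos)
  qed
  have dh: "(h has_real_derivative \<kappa> * (- \<alpha> / (sin (\<kappa> * \<theta>))\<^sup>2 - \<gamma> / 2 / (cos (\<kappa> * \<theta>))\<^sup>2)) (at \<theta>)"
  proof -
    define s c where "s = sin (\<kappa> * \<theta>)" and "c = cos (\<kappa> * \<theta>)"
    have sc: "s\<^sup>2 + c\<^sup>2 = 1" by (simp add: s_def c_def)
    have "(h has_real_derivative \<alpha> * ((- s * \<kappa>) * s - c * (c * \<kappa>)) / (s * s) - \<gamma> / 2 * ((c * \<kappa>) * c - s * (- s * \<kappa>)) / (c * c)) (at \<theta>)"
      unfolding h_def s_def c_def using nz
      by (auto intro!: derivative_eq_intros simp: field_simps)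
    also have "(- s * \<kappa>) * s - c * (c * \<kappa>) = - \<kappa>" using sc by algebra
    also have "(c * \<kappa>) * c - s * (- s * \<kappa>) = \<kappa>" using sc by algebra
    finally show ?thesis unfolding s_def c_def by (simp add: power2_eq_square algebra_simps)
  qed
  have dp: "((\<lambda>\<theta>. poly q (cos (\<kappa> * \<theta>))) has_real_derivative - \<kappa> * sin (\<kappa> * \<theta>) * poly (pderiv q) (cos (\<kappa> * \<theta>))) (at \<theta>)" for q
    using DERIV_chain2[OF poly_DERIV, of "\<lambda>\<theta>. cos (\<kappa> * \<theta>)" "- \<kappa> * sin (\<kappa> * \<theta>)" \<theta> UNIV q]
    by (auto intro!: derivative_eq_intros simp: mult_ac)
  show "(?w has_real_derivative ?w' \<theta>) (at \<theta>)"
    by (rule DERIV_cong[OF DERIV_mult[OF d\<sigma> dp]]) (simp add: algebra_simps)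
  define s c P D D2 H where "s = sin (\<kappa> * \<theta>)" "c = cos (\<kappa> * \<theta>)" "P = poly p c" "D = poly (pderiv p) c"
    "D2 = poly (pderiv (pderiv p)) c" "H = h \<theta>"
  note defs = this
  have sc: "s\<^sup>2 = 1 - c\<^sup>2" using sin_squared_eq by (simp add: defs)
  have c2: "c\<^sup>2 = 1 - s\<^sup>2" using sc by simp
  have s0: "s \<noteq> 0" "c \<noteq> 0" using nz by (auto simp: defs)
  have dsin: "((\<lambda>\<theta>. sin (\<kappa> * \<theta>)) has_real_derivative \<kappa> * cos (\<kappa> * \<theta>)) (at \<theta>)"
    by (auto intro!: derivative_eq_intros)
  have ode: "c * s\<^sup>2 * D2 = ((2 * \<alpha> + \<gamma> + 1) * c\<^sup>2 - \<gamma>) * D - real n * (real n + 2 * \<alpha> + \<gamma>) * c * P"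
  proof -
    have "1 - c\<^sup>2 \<noteq> 0" using sc s0 by (metis power_not_zero)
    from gegenbauer_ode[OF assms(1,2) this assms(3)] show ?thesis
      unfolding sc[symmetric] defs(3-5) p_def by simp
  qed
  have H: "H = \<alpha> * c / s - \<gamma> / 2 * s / c" by (simp add: defs h_def)
  have *: "?w' = (\<lambda>\<theta>. \<kappa> * (\<sigma> \<theta> * (h \<theta> * poly p (cos (\<kappa> * \<theta>)) - sin (\<kappa> * \<theta>) * poly (pderiv p) (cos (\<kappa> * \<theta>)))))"
    by (simp add: mult.assoc)
  have "(?w' has_real_derivative \<kappa> * ((\<kappa> * \<sigma> \<theta> * H) * (H * P - s * D) +
      (((\<kappa> * (- \<alpha> / s\<^sup>2 - \<gamma> / 2 / c\<^sup>2)) * P + (- \<kappa> * s * D) * H)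
       - (\<kappa> * c * D + (- \<kappa> * s * D2) * s)) * \<sigma> \<theta>)) (at \<theta>)"
    unfolding * defs
    by (intro DERIV_cmult DERIV_mult DERIV_diff d\<sigma> dh dp dsin)
  also have "\<kappa> * ((\<kappa> * \<sigma> \<theta> * H) * (H * P - s * D) +
      (((\<kappa> * (- \<alpha> / s\<^sup>2 - \<gamma> / 2 / c\<^sup>2)) * P + (- \<kappa> * s * D) * H)
       - (\<kappa> * c * D + (- \<kappa> * s * D2) * s)) * \<sigma> \<theta>)
     = \<kappa>\<^sup>2 * \<sigma> \<theta> * (H\<^sup>2 * P - 2 * H * s * D - (\<alpha> / s\<^sup>2 + \<gamma> / 2 / c\<^sup>2) * P - c * D + s\<^sup>2 * D2)"
    by (simp add: power2_eq_square algebra_simps)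
  also have "s\<^sup>2 * D2 = (c * s\<^sup>2 * D2) / c" using s0 by simp
  also have "\<dots> = ((2 * \<alpha> + \<gamma> + 1) * c - \<gamma> / c) * D - real n * (real n + 2 * \<alpha> + \<gamma>) * P"
    unfolding ode using s0 by (simp add: field_simps power2_eq_square)
  also have "2 * H * s * D = (2 * \<alpha> * c - \<gamma> * s\<^sup>2 / c) * D"
    unfolding H using s0 by (simp add: field_simps power2_eq_square)
  also have "\<dots> = (2 * \<alpha> * c - \<gamma> / c + \<gamma> * c) * D"
    unfolding sc using s0 by (simp add: field_simps power2_eq_square)
  also have "H\<^sup>2 = \<alpha>\<^sup>2 * (c\<^sup>2 / s\<^sup>2) - \<alpha> * \<gamma> + \<gamma>\<^sup>2 / 4 * (s\<^sup>2 / c\<^sup>2)"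
    unfolding H using s0 by (simp add: power2_diff power_mult_distrib power_divide)
  also have "c\<^sup>2 / s\<^sup>2 = 1 / s\<^sup>2 - 1"
    using s0 by (simp add: c2 diff_divide_distrib)
  also have "s\<^sup>2 / c\<^sup>2 = 1 / c\<^sup>2 - 1"
    using s0 by (simp add: sc diff_divide_distrib)
  finally have D: "(?w' has_real_derivative \<kappa>\<^sup>2 * \<sigma> \<theta> *
     ((\<alpha>\<^sup>2 * (1 / s\<^sup>2 - 1) - \<alpha> * \<gamma> + \<gamma>\<^sup>2 / 4 * (1 / c\<^sup>2 - 1)) * P -
      (2 * \<alpha> * c - \<gamma> / c + \<gamma> * c) * D - (\<alpha> / s\<^sup>2 + \<gamma> / 2 / c\<^sup>2) * P - c * D +
      (((2 * \<alpha> + \<gamma> + 1) * c - \<gamma> / c) * D - real n * (real n + 2 * \<alpha> + \<gamma>) * P))) (at \<theta>)" .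
  \<comment> \<open>With \<open>A\<close>, \<open>B\<close> and \<open>g\<close> standing for the
    three quotients the identity is polynomial; all terms containing \<open>D\<close>
    cancel.\<close>
  have "((\<alpha>\<^sup>2 * (A - 1) - \<alpha> * \<gamma> + \<gamma>\<^sup>2 / 4 * (B - 1)) * P -
      (2 * \<alpha> * c - g + \<gamma> * c) * D - (\<alpha> * A + \<gamma> / 2 * B) * P - c * D +
      (((2 * \<alpha> + \<gamma> + 1) * c - g) * D - n' * (n' + 2 * \<alpha> + \<gamma>) * P))
    = - ((n' + \<alpha> + \<gamma> / 2)\<^sup>2 + (\<alpha> - \<alpha>\<^sup>2) * A + (\<gamma> / 2 - \<gamma>\<^sup>2 / 4) * B) * P" for A B g n'
    by (simp add: power2_eq_square field_simps)
  note core = this[of "1 / s\<^sup>2" "1 / c\<^sup>2" "\<gamma> / c" "real n"]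
  have e: "\<alpha> / s\<^sup>2 = \<alpha> * (1 / s\<^sup>2)" "\<gamma> / 2 / c\<^sup>2 = \<gamma> / 2 * (1 / c\<^sup>2)"
    "(\<alpha> - \<alpha>\<^sup>2) / s\<^sup>2 = (\<alpha> - \<alpha>\<^sup>2) * (1 / s\<^sup>2)"
    "(\<gamma> / 2 - \<gamma>\<^sup>2 / 4) / c\<^sup>2 = (\<gamma> / 2 - \<gamma>\<^sup>2 / 4) * (1 / c\<^sup>2)"
    by simp_all
  show "(?w' has_real_derivative - F \<theta> * ?w \<theta>) (at \<theta>)"
    by (rule DERIV_cong[OF D], simp only: F_def defs[symmetric] e core) (simp only: mult_ac minus_mult_left minus_mult_right)
qed

section \<open>Sturm comparison\<close>

text \<open>The Wronskian \<open>u' v - u v'\<close> would be strictly increasing, yet nonnegative at the first zero of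
  \<open>u\<close> and nonpositive at the second.\<close>

lemma sturm_comparison:
  fixes u v u' v' u'' v'' :: "real \<Rightarrow> real"
  assumes "p < q" "u p = 0" "u q = 0"
    and u: "\<And>x. p < x \<Longrightarrow> x < q \<Longrightarrow> u x > 0" and v: "\<And>x. p < x \<Longrightarrow> x < q \<Longrightarrow> v x > 0"
    and du: "\<And>x. x \<in> {p..q} \<Longrightarrow> (u has_real_derivative u' x) (at x)"
      "\<And>x. x \<in> {p..q} \<Longrightarrow> (u' has_real_derivative u'' x) (at x)"
    and dv: "\<And>x. x \<in> {p..q} \<Longrightarrow> (v has_real_derivative v' x) (at x)"
      "\<And>x. x \<in> {p..q} \<Longrightarrow> (v' has_real_derivative v'' x) (at x)"
    and gt: "\<And>x. p < x \<Longrightarrow> x < q \<Longrightarrow> u'' x * v x > u x * v'' x"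
  shows False
proof -
  define W where "W = (\<lambda>x. u' x * v x - u x * v' x)"
  have dW: "(W has_real_derivative u'' x * v x - u x * v'' x) (at x)" if "x \<in> {p..q}" for x
    unfolding W_def using du[OF that] dv[OF that]
    by (auto intro!: derivative_eq_intros)
  have "W p < W q"
  proof (rule DERIV_pos_imp_increasing_open[OF \<open>p < q\<close>])
    show "\<exists>y. (W has_real_derivative y) (at x) \<and> 0 < y" if "p < x" "x < q" for x
      using dW[of x] gt[of x] that by (intro exI[of _ "u'' x * v x - u x * v'' x"]) auto
    show "continuous_on {p..q} W"
      by (intro continuous_at_imp_continuous_on ballI DERIV_isCont[OF dW])
  qed
  \<comment> \<open>Positivity is assumed only inside, since \<open>v\<close> may vanish at the
    ends, as it may in \<open>zero_between\<close>; the signs at the ends follow by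
    continuity.\<close>
  have vpq: "v p \<ge> 0" "v q \<ge> 0"
  proof -
    have cont: "continuous_on {p..q} v"
      by (intro continuous_at_imp_continuous_on ballI DERIV_isCont[OF dv(1)])
    have "v x \<ge> 0" if "x \<in> closure {p<..<q}" for x
      using continuous_ge_on_closure[of "{p<..<q}" v x 0] cont that v \<open>p < q\<close> by fastforce
    then show "v p \<ge> 0" "v q \<ge> 0" using \<open>p < q\<close> by auto
  qed
  have "u' p \<ge> 0"
  proof (rule ccontr)
    assume "\<not> ?thesis"
    then obtain d where d: "d > 0" "\<And>h. 0 < h \<Longrightarrow> h < d \<Longrightarrow> u (p + h) < u p"
      using DERIV_neg_dec_right[OF du(1)[of p]] \<open>p < q\<close> by force
    define h where "h = min d (q - p) / 2"
    have h: "0 < h" "h < d" "p + h < q" unfolding h_def using d \<open>p < q\<close> by (auto simp: min_def field_simps)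
    show False using d(2)[of h] u[of "p + h"] h assms(2) by auto
  qed
  moreover have "u' q \<le> 0"
  proof (rule ccontr)
    assume "\<not> ?thesis"
    then obtain d where d: "d > 0" "\<And>h. 0 < h \<Longrightarrow> h < d \<Longrightarrow> u (q - h) < u q"
      using DERIV_pos_inc_left[OF du(1)[of q]] \<open>p < q\<close> by force
    define h where "h = min d (q - p) / 2"
    have h: "0 < h" "h < d" "p < q - h" unfolding h_def using d \<open>p < q\<close> by (auto simp: min_def field_simps)
    show False using d(2)[of h] u[of "q - h"] h assms(3) by auto
  qed
  ultimately have "W p \<ge> 0" "W q \<le> 0"
    using assms(2,3) vpq by (simp_all add: W_def mult_nonpos_nonneg)
  then show False using \<open>W p < W q\<close> by simp
qed

lemma continuous_nonzero_sign:
  fixes w :: "real \<Rightarrow> real"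
  assumes "continuous_on {p<..<q} w" and nz: "\<And>x. p < x \<Longrightarrow> x < q \<Longrightarrow> w x \<noteq> 0"
  shows "(\<forall>x\<in>{p<..<q}. w x > 0) \<or> (\<forall>x\<in>{p<..<q}. w x < 0)"
proof (rule ccontr)
  assume "\<not> ?thesis"
  then obtain x y where xy: "x \<in> {p<..<q}" "y \<in> {p<..<q}" "w x \<le> 0" "w y \<ge> 0" by (auto simp: not_less)
  have "connected (w ` {p<..<q})" using assms(1) by (intro connected_continuous_image) auto
  then have "0 \<in> w ` {p<..<q}" using xy connectedD_interval[of "w ` {p<..<q}" "w x" "w y" 0] by auto
  then show False using nz by auto
qed

locale sturm_equation =
  fixes w w' F :: "real \<Rightarrow> real" and a b :: real
  assumes dw: "\<And>x. a < x \<Longrightarrow> x < b \<Longrightarrow> (w has_real_derivative w' x) (at x)"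
    and dw': "\<And>x. a < x \<Longrightarrow> x < b \<Longrightarrow> (w' has_real_derivative - F x * w x) (at x)"
begin

lemma continuous_on_w: "a < p \<Longrightarrow> q < b \<Longrightarrow> continuous_on {p..q} w"
  by (intro continuous_at_imp_continuous_on ballI DERIV_isCont[OF dw]) auto

text \<open>Since \<open>F\<close> exceeds \<open>m^2\<close>, \<open>w\<close> oscillates faster
  than \<open>sin (m * (x - p))\<close>, one half wave of which fills the interval.\<close>

lemma zero_between:
  assumes "m > 0" "a < p" "p + pi / m < b" and F: "\<And>x. a < x \<Longrightarrow> x < b \<Longrightarrow> F x > m\<^sup>2"
  shows "\<exists>x. p < x \<and> x < p + pi / m \<and> w x = 0"
proof (rule ccontr)
  assume neg: "\<not> ?thesis"
  define q where "q = p + pi / m"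
  have q: "p < q" "q < b" using assms by (auto simp: q_def)
  have "continuous_on {p<..<q} w"
    using continuous_on_w[of p q] assms q by (auto intro: continuous_on_subset)
  then consider "\<And>x. p < x \<Longrightarrow> x < q \<Longrightarrow> w x > 0" | "\<And>x. p < x \<Longrightarrow> x < q \<Longrightarrow> w x < 0"
    using continuous_nonzero_sign[of p q w] neg by (auto simp: q_def)
  then obtain s :: real where s: "s \<noteq> 0" "\<And>x. p < x \<Longrightarrow> x < q \<Longrightarrow> s * w x > 0"
    by cases (metis mult_1 zero_neq_one, metis mult_minus1 neg_0_less_iff_less neg_equal_0_iff_equal zero_neq_one)
  let ?u = "\<lambda>x. sin (m * (x - p))"
  show False
  proof (rule sturm_comparison[of p q ?u "\<lambda>x. s * w x" "\<lambda>x. m * cos (m * (x - p))" "\<lambda>x. - m\<^sup>2 * ?u x"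
        "\<lambda>x. s * w' x" "\<lambda>x. s * (- F x * w x)"])
    show pos: "?u x > 0" if "p < x" "x < q" for x
      using that assms(1) by (intro sin_gt_zero) (auto simp: q_def field_simps)
    show "?u x * (s * (- F x * w x)) < - m\<^sup>2 * ?u x * (s * w x)" if "p < x" "x < q" for x
    proof -
      have "0 < (F x - m\<^sup>2) * (?u x * (s * w x))"
        using F[of x] that assms q by (intro mult_pos_pos[OF _ mult_pos_pos[OF pos s(2)]]) auto
      then show ?thesis by (simp add: algebra_simps)
    qed
  qed (use q assms s in \<open>auto intro!: derivative_eq_intros dw dw' simp: q_def power2_eq_square\<close>)
qed

text \<open>Source of the upper bounds on zero counts. Compared with \<open>zero_between\<close> the
  roles are exchanged: \<open>w\<close> supplies the half wave and \<open>v\<close> is the positive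
  supersolution. Finiteness provides a first zero \<open>r\<close> after \<open>p\<close>, so that
  \<open>w\<close> has constant sign between \<open>p\<close> and \<open>r\<close>.\<close>

lemma no_zero_pair:
  assumes "a < p" "p < q" "q < b" "w p = 0" "w q = 0" "finite {x. a < x \<and> x < b \<and> w x = 0}"
    and v: "\<And>x. p \<le> x \<Longrightarrow> x < q \<Longrightarrow> v x > 0"
    and dv: "\<And>x. x \<in> {p..q} \<Longrightarrow> (v has_real_derivative v' x) (at x)"
      "\<And>x. x \<in> {p..q} \<Longrightarrow> (v' has_real_derivative v'' x) (at x)"
    and gt: "\<And>x. p < x \<Longrightarrow> x < q \<Longrightarrow> - v'' x > F x * v x"
  shows False
proof -
  let ?S = "{x. p < x \<and> x \<le> q \<and> w x = 0}"
  have fin: "finite ?S" by (rule finite_subset[OF _ assms(6)]) (use assms in auto)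
  define r where "r = Min ?S"
  have "?S \<noteq> {}" using assms by auto
  then have r: "r \<in> ?S" unfolding r_def by (rule Min_in[OF fin])
  have rmin: "r \<le> x" if "x \<in> ?S" for x unfolding r_def using fin that by (rule Min_le)
  have nz: "w x \<noteq> 0" if "p < x" "x < r" for x using rmin[of x] that r by fastforce
  have "continuous_on {p<..<r} w"
    using continuous_on_w[of p r] assms r by (auto intro: continuous_on_subset)
  then consider "\<And>x. p < x \<Longrightarrow> x < r \<Longrightarrow> w x > 0" | "\<And>x. p < x \<Longrightarrow> x < r \<Longrightarrow> w x < 0"
    using continuous_nonzero_sign[of p r w] nz by auto
  then obtain s :: real where s: "s \<noteq> 0" "\<And>x. p < x \<Longrightarrow> x < r \<Longrightarrow> s * w x > 0"
    by cases (metis mult_1 zero_neq_one, metis mult_minus1 neg_0_less_iff_less neg_equal_0_iff_equal zero_neq_one)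
  show False
  proof (rule sturm_comparison[of p r "\<lambda>x. s * w x" v "\<lambda>x. s * w' x" "\<lambda>x. s * (- F x * w x)" v' v''])
    show "s * w x * v'' x < s * (- F x * w x) * v x" if "p < x" "x < r" for x
    proof -
      have "0 < (- v'' x - F x * v x) * (s * w x)"
        using gt[of x] that r by (intro mult_pos_pos[OF _ s(2)]) auto
      then show ?thesis by (simp add: algebra_simps)
    qed
  qed (use r assms s in \<open>auto intro!: derivative_eq_intros dw dw' dv v\<close>)
qed

lemma zero_spacing:
  assumes "m > 0" "a < p" "p < q" "q < b" "w p = 0" "w q = 0" "finite {x. a < x \<and> x < b \<and> w x = 0}"
    and F: "\<And>x. a < x \<Longrightarrow> x < b \<Longrightarrow> F x < m\<^sup>2"
  shows "q - p \<ge> pi / m"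
proof (rule ccontr)
  assume neg: "\<not> ?thesis"
  \<comment> \<open>Half of the slack: moving the sine to the left by \<open>e\<close> makes it
    positive on the closed interval, at \<open>p\<close> as well as at \<open>q\<close>.\<close>
  define e where "e = (pi / m - (q - p)) / 2"
  have "2 * e = pi / m - (q - p)" by (simp add: e_def)
  then have e: "e > 0" and e': "q - p + e < pi / m" using neg by linarith+
  let ?v = "\<lambda>x. sin (m * (x - p + e))"
  have pos: "?v x > 0" if "p \<le> x" "x \<le> q" for x
  proof (rule sin_gt_zero)
    have "x - p + e < pi / m" using e' that by linarith
    then show "m * (x - p + e) < pi" using assms(1) by (simp add: field_simps)
  qed (use e that assms in auto)
  show False
  proof (rule no_zero_pair[of p q ?v "\<lambda>x. m * cos (m * (x - p + e))" "\<lambda>x. - m\<^sup>2 * ?v x"])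
    show "F x * ?v x < - (- m\<^sup>2 * ?v x)" if "p < x" "x < q" for x
      using F[of x] pos[of x] that assms by simp
  qed (use assms pos in \<open>auto intro!: derivative_eq_intros simp: power2_eq_square\<close>)
qed

text \<open>At a singular endpoint with an inverse square term of the critical size, a supersolution is
  \<open>sqrt (x - a) * cos (m * (x - p))\<close>.\<close>

lemma zero_spacing_singular:
  assumes "m > 0" "a < p" "p < q" "q < b" "w p = 0" "w q = 0" "finite {x. a < x \<and> x < b \<and> w x = 0}"
    and F: "\<And>x. a < x \<Longrightarrow> x < b \<Longrightarrow> F x < m\<^sup>2 + 1 / (4 * (x - a)\<^sup>2)"
  shows "q - p \<ge> pi / (2 * m)"
proof (rule ccontr)
  assume neg: "\<not> ?thesis"
  let ?v = "\<lambda>x. sqrt (x - a) * cos (m * (x - p))"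
  let ?v' = "\<lambda>x. 1 / (2 * sqrt (x - a)) * cos (m * (x - p)) - sqrt (x - a) * (m * sin (m * (x - p)))"
  let ?v'' = "\<lambda>x. - (m\<^sup>2 + 1 / (4 * (x - a)\<^sup>2)) * ?v x - m * sin (m * (x - p)) / sqrt (x - a)"
  \<comment> \<open>Only a quarter wave is used, whence the factor 2 in the spacing: the cosine must
    be positive for \<open>?v > 0\<close>, and the sine nonnegative so that the extra term of
    \<open>- ?v''\<close> has the favourable sign.\<close>
  have ang: "0 \<le> m * (x - p)" "m * (x - p) < pi / 2" if "p \<le> x" "x \<le> q" for x
  proof -
    have "x - p < pi / (2 * m)" using neg that by linarith
    then show "m * (x - p) < pi / 2" using assms(1) by (simp add: field_simps)
  qed (use that assms in auto)
  have pos: "?v x > 0" if "p \<le> x" "x \<le> q" for x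
    using ang[OF that] that assms pi_gt_zero
    by (intro mult_pos_pos cos_gt_zero_pi real_sqrt_gt_zero) linarith+
  have spos: "m * sin (m * (x - p)) / sqrt (x - a) \<ge> 0" if "p \<le> x" "x \<le> q" for x
    using ang[OF that] that assms pi_gt_zero
    by (intro divide_nonneg_nonneg mult_nonneg_nonneg[of m] sin_ge_zero real_sqrt_ge_zero) linarith+
  show False
  proof (rule no_zero_pair[of p q ?v ?v' ?v''])
    show "F x * ?v x < - ?v'' x" if "p < x" "x < q" for x
    proof -
      have "0 < (m\<^sup>2 + 1 / (4 * (x - a)\<^sup>2) - F x) * ?v x"
        using F[of x] that assms by (intro mult_pos_pos[OF _ pos]) auto
      then have "F x * ?v x < (m\<^sup>2 + 1 / (4 * (x - a)\<^sup>2)) * ?v x"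
        by (simp only: left_diff_distrib diff_gt_0_iff_gt)
      moreover have "m * sin (m * (x - p)) / sqrt (x - a) \<ge> 0" using spos[of x] that by linarith
      ultimately show ?thesis by linarith
    qed
    fix x assume x: "x \<in> {p..q}"
    then have xa: "x > a" using assms by auto
    have dsq: "((\<lambda>x. sqrt (x - a)) has_real_derivative 1 / (2 * sqrt (x - a))) (at x)"
      using xa by (auto intro!: derivative_eq_intros simp: field_simps)
    have dc: "((\<lambda>x. cos (m * (x - p))) has_real_derivative - (m * sin (m * (x - p)))) (at x)"
      and dsn: "((\<lambda>x. m * sin (m * (x - p))) has_real_derivative m * (m * cos (m * (x - p)))) (at x)"
      by (auto intro!: derivative_eq_intros)
    show "(?v has_real_derivative ?v' x) (at x)"
      by (rule DERIV_cong[OF DERIV_mult[OF dsq dc]]) (simp add: algebra_simps)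
    define s where "s = sqrt (x - a)"
    have s: "s > 0" "x - a = s\<^sup>2" using xa by (auto simp: s_def)
    have dinv: "((\<lambda>x. 1 / (2 * sqrt (x - a))) has_real_derivative - (1 / (4 * s ^ 3))) (at x)"
    proof -
      have "((\<lambda>x. 1 / (2 * sqrt (x - a))) has_real_derivative (0 * (2 * sqrt (x - a)) - 1 * (2 * (1 / (2 * sqrt (x - a))))) / ((2 * sqrt (x - a)) * (2 * sqrt (x - a)))) (at x)"
        using xa by (intro DERIV_divide DERIV_const DERIV_cmult dsq) auto
      then show ?thesis by (rule DERIV_cong) (use s in \<open>simp add: s_def[symmetric] field_simps power3_eq_cube\<close>)
    qed
    show "(?v' has_real_derivative ?v'' x) (at x)"
      by (rule DERIV_cong[OF DERIV_diff[OF DERIV_mult[OF dinv dc] DERIV_mult[OF dsq dsn]]])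
        (use s(1) in \<open>simp add: s_def[symmetric] s(2) field_simps power2_eq_square power3_eq_cube\<close>)
  qed (use assms pos in auto)
qed

end

section \<open>Counting points on the line from their spacing\<close>

lemma card_le_if_spaced:
  fixes A :: "real set"
  assumes "A \<subseteq> {u..v}" "u \<le> v" "d > 0" and sp: "\<And>p q. p \<in> A \<Longrightarrow> q \<in> A \<Longrightarrow> p < q \<Longrightarrow> q - p \<ge> d"
  shows "real (card A) \<le> (v - u) / d + 1"
proof -
  \<comment> \<open>The number of the cell of length \<open>d\<close> that contains the point;
    spaced points lie in different cells.\<close>
  define f where "f = (\<lambda>x. nat \<lfloor>(x - u) / d\<rfloor>)"
  have "inj_on f A"
  proof (rule linorder_inj_onI')
    fix p q assume pq: "p \<in> A" "q \<in> A" "p < q"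
    then have "(p - u) / d + 1 \<le> (q - u) / d"
      using divide_right_mono[of "p - u + d" "q - u" d] sp[OF pq] assms(3) by (simp add: add_divide_distrib)
    moreover have "(p - u) / d \<ge> 0" using pq assms by (auto intro!: divide_nonneg_pos)
    ultimately show "f p \<noteq> f q" unfolding f_def by linarith
  qed
  moreover have "f ` A \<subseteq> {..nat \<lfloor>(v - u) / d\<rfloor>}"
    using assms by (auto simp: f_def intro!: nat_mono floor_mono divide_right_mono)
  ultimately have "card A \<le> card {..nat \<lfloor>(v - u) / d\<rfloor>}" by (intro card_inj_on_le) auto
  then have "card A \<le> nat \<lfloor>(v - u) / d\<rfloor> + 1" by simp
  moreover have "(v - u) / d \<ge> 0" using assms by auto
  ultimately show ?thesis by linarith
qed

lemma card_ge_if_dense: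
  fixes A :: "real set"
  assumes "finite A" "u \<le> v" "d > 0" and dn: "\<And>p. u \<le> p \<Longrightarrow> p + d \<le> v \<Longrightarrow> \<exists>x\<in>A. p < x \<and> x < p + d"
  shows "real (card A) \<ge> (v - u) / d - 1"
proof -
  define n where "n = nat \<lfloor>(v - u) / d\<rfloor>"
  have ge: "(v - u) / d \<ge> 0" using assms by auto
  have "\<exists>x\<in>A. u + real i * d < x \<and> x < u + real i * d + d" if "i < n" for i
  proof (rule dn)
    have "real i + 1 \<le> (v - u) / d" using that ge unfolding n_def by linarith
    then show "u + real i * d + d \<le> v" using assms(3) by (simp add: field_simps)
  qed (use assms in auto)
  then obtain f where f: "\<And>i. i < n \<Longrightarrow> f i \<in> A \<and> u + real i * d < f i \<and> f i < u + real i * d + d" by metis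
  have "inj_on f {..<n}"
  proof (rule linorder_inj_onI')
    fix i j assume ij: "i \<in> {..<n}" "j \<in> {..<n}" "i < j"
    have "u + real i * d + d = u + real (Suc i) * d" by (simp add: algebra_simps)
    also have "\<dots> \<le> u + real j * d" using ij assms(3) by (intro add_left_mono mult_right_mono) auto
    finally show "f i \<noteq> f j" using f[of i] f[of j] ij by auto
  qed
  then have "card {..<n} \<le> card A" using f assms(1) by (intro card_inj_on_le) auto
  then show ?thesis unfolding n_def using ge by simp linarith
qed

section \<open>Gluing local densities\<close>

text \<open>A set function with density \<open>g\<close> off a finite set \<open>S\<close> is glued from its local behaviour by
  bisection. At the points of \<open>S\<close> an error \<open>C * (v - u)\<close> is absorbed by the increment of
  \<open>\<tau>\<close>, which has infinite slope there (\<open>sqrt\<close> is odd on the reals).\<close>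

lemma tendsto_integral_from_local_density:
  fixes N :: "nat \<Rightarrow> real \<Rightarrow> real \<Rightarrow> real" and g :: "real \<Rightarrow> real"
  assumes "p \<le> q" "finite S"
    and add: "\<And>n u v w. p \<le> u \<Longrightarrow> u \<le> v \<Longrightarrow> v \<le> w \<Longrightarrow> w \<le> q \<Longrightarrow> N n u w = N n u v + N n v w"
    and int: "g integrable_on {p..q}" and bdd: "\<And>x. x \<in> {p..q} \<Longrightarrow> \<bar>g x\<bar> \<le> B"
    and cont: "\<And>x. x \<in> {p..q} - S \<Longrightarrow> isCont g x"
    and reg: "\<And>x e. x \<in> {p..q} - S \<Longrightarrow> e > 0 \<Longrightarrow> \<exists>d>0. \<forall>u v. p \<le> u \<and> u \<le> x \<and> x \<le> v \<and> v \<le> q \<and> u < v \<and> v - u < d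
      \<longrightarrow> (\<forall>\<^sub>F n in sequentially. \<bar>N n u v - g x * (v - u)\<bar> \<le> e * (v - u))"
    and sing: "\<And>x. x \<in> {p..q} \<inter> S \<Longrightarrow> \<exists>C. \<exists>d>0. \<forall>u v. p \<le> u \<and> u \<le> x \<and> x \<le> v \<and> v \<le> q \<and> u < v \<and> v - u < d
      \<longrightarrow> (\<forall>\<^sub>F n in sequentially. \<bar>N n u v\<bar> \<le> C * (v - u))"
  shows "(\<lambda>n. N n p q) \<longlonglongrightarrow> integral {p..q} g"
proof -
  define \<tau> where "\<tau> = (\<lambda>x. \<Sum>s\<in>S. sqrt (x - s))"
  have \<tau>_mono: "\<tau> u \<le> \<tau> v" if "u \<le> v" for u v
    unfolding \<tau>_def using that by (intro sum_mono) simp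
  have \<tau>_ge: "sqrt (v - x) + sqrt (x - u) \<le> \<tau> v - \<tau> u" if "x \<in> S" "u \<le> x" "x \<le> v" for u v x
  proof -
    have "sqrt (v - x) - sqrt (u - x) \<le> (\<Sum>s\<in>S. sqrt (v - s) - sqrt (u - s))"
      using that assms(2) by (intro member_le_sum) auto
    moreover have "sqrt (u - x) = - sqrt (x - u)" by (metis minus_diff_eq real_sqrt_minus)
    ultimately show ?thesis by (simp add: \<tau>_def sum_subtractf)
  qed
  have int': "g integrable_on {u..v}" if "p \<le> u" "v \<le> q" for u v
    by (rule integrable_on_subinterval[OF int]) (use that in auto)
  \<comment> \<open>Both parts of the error bound are additive over adjacent intervals, so the bound
    survives bisection. The length pays for regular points, the increment of \<open>\<tau>\<close>
    for singular ones.\<close>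
  have main: "\<forall>\<^sub>F n in sequentially. \<bar>N n p q - integral {p..q} g\<bar> \<le> e * (q - p) + e * (\<tau> q - \<tau> p)"
    if e: "e > 0" for e
  proof -
    have N0: "N n u u = 0" if "p \<le> u" "u \<le> q" for n u using add[of u u u n] that by simp
    define P where "P = (\<lambda>u v. p \<le> u \<longrightarrow> u \<le> v \<longrightarrow> v \<le> q \<longrightarrow>
      (\<forall>\<^sub>F n in sequentially. \<bar>N n u v - integral {u..v} g\<bar> \<le> e * (v - u) + e * (\<tau> v - \<tau> u)))"
    have "P p q"
    proof (rule Bolzano[OF assms(1)])
      fix u v w assume H: "P u v" "P v w" "u \<le> v" "v \<le> w"
      show "P u w" unfolding P_def
      proof (intro impI)
        assume b: "p \<le> u" "u \<le> w" "w \<le> q"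
        have "\<forall>\<^sub>F n in sequentially. \<bar>N n u v - integral {u..v} g\<bar> \<le> e * (v - u) + e * (\<tau> v - \<tau> u)"
          "\<forall>\<^sub>F n in sequentially. \<bar>N n v w - integral {v..w} g\<bar> \<le> e * (w - v) + e * (\<tau> w - \<tau> v)"
          using H b unfolding P_def by simp_all
        then show "\<forall>\<^sub>F n in sequentially. \<bar>N n u w - integral {u..w} g\<bar> \<le> e * (w - u) + e * (\<tau> w - \<tau> u)"
        proof eventually_elim
          case (elim n)
          have "N n u w = N n u v + N n v w" by (rule add) (use H b in auto)
          moreover have "integral {u..w} g = integral {u..v} g + integral {v..w} g"
            using Henstock_Kurzweil_Integration.integral_combine[OF H(3,4) int'] b by simp
          moreover have "e * (w - u) + e * (\<tau> w - \<tau> u) = (e * (v - u) + e * (\<tau> v - \<tau> u)) + (e * (w - v) + e * (\<tau> w - \<tau> v))"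
            by (simp add: algebra_simps)
          ultimately show ?case using elim by linarith
        qed
      qed
    next
      fix x assume x: "p \<le> x" "x \<le> q"
      have triv: "P u v" if "u = v" for u v
        unfolding P_def using that N0 by auto
      show "\<exists>d>0. \<forall>u v. u \<le> x \<and> x \<le> v \<and> v - u < d \<longrightarrow> P u v"
      proof (cases "x \<in> S")
        case False
        have ih: "e / 2 > 0" using e by simp
        obtain d1 where d1: "d1 > 0" "\<And>u v. p \<le> u \<and> u \<le> x \<and> x \<le> v \<and> v \<le> q \<and> u < v \<and> v - u < d1
            \<longrightarrow> (\<forall>\<^sub>F n in sequentially. \<bar>N n u v - g x * (v - u)\<bar> \<le> e / 2 * (v - u))"
        proof -
          have "x \<in> {p..q} - S" using x False by simp
          from reg[OF this ih] show thesis using that by (elim exE conjE) simp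
        qed
        obtain d2 where d2: "d2 > 0" "\<And>z. \<bar>z - x\<bar> < d2 \<Longrightarrow> \<bar>g z - g x\<bar> < e / 2"
        proof -
          have "isCont g x" by (rule cont) (use x False in simp)
          then have c: "\<forall>e>0. \<exists>d>0. \<forall>z. dist z x < d \<longrightarrow> dist (g z) (g x) < e"
            unfolding continuous_at_eps_delta .
          have "\<exists>d>0. \<forall>z. dist z x < d \<longrightarrow> dist (g z) (g x) < e / 2"
            by (rule mp[OF spec[OF c] ih])
          then obtain d where d: "d > 0" "\<forall>z. dist z x < d \<longrightarrow> dist (g z) (g x) < e / 2" by (elim exE conjE)
          from d(1) show thesis by (rule that) (use d(2) in \<open>simp add: dist_real_def\<close>)
        qed
        have "P u v" if uv: "u \<le> x" "x \<le> v" "v - u < min d1 d2" for u v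
        proof (cases "u = v")
          case ne: False
          show ?thesis unfolding P_def
          proof (intro impI)
            assume b: "p \<le> u" "u \<le> v" "v \<le> q"
            have I: "\<bar>integral {u..v} g - g x * (v - u)\<bar> \<le> e / 2 * (v - u)"
            proof -
              have near: "\<bar>g z - g x\<bar> < e / 2" if "z \<in> {u..v}" for z
                using that uv by (intro d2) auto
              have "integral {u..v} g \<le> integral {u..v} (\<lambda>_. g x + e / 2)"
                by (rule integral_le[OF int'[OF b(1,3)] integrable_const_ivl]) (drule near, linarith)
              moreover have "integral {u..v} g \<ge> integral {u..v} (\<lambda>_. g x - e / 2)"
                by (rule integral_le[OF integrable_const_ivl int'[OF b(1,3)]]) (drule near, linarith)
              moreover have "integral {u..v} (\<lambda>_. g x + e / 2) = g x * (v - u) + e / 2 * (v - u)"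
                "integral {u..v} (\<lambda>_. g x - e / 2) = g x * (v - u) - e / 2 * (v - u)"
                unfolding distrib_right[symmetric] left_diff_distrib[symmetric] using b by (simp_all add: mult.commute)
              ultimately show ?thesis by linarith
            qed
            have "\<forall>\<^sub>F n in sequentially. \<bar>N n u v - g x * (v - u)\<bar> \<le> e / 2 * (v - u)"
              using d1(2)[of u v] uv b ne by auto
            then show "\<forall>\<^sub>F n in sequentially. \<bar>N n u v - integral {u..v} g\<bar> \<le> e * (v - u) + e * (\<tau> v - \<tau> u)"
            proof eventually_elim
              case (elim n)
              have "0 \<le> e * (\<tau> v - \<tau> u)" using \<tau>_mono[of u v] b e by simp
              then show ?case using elim I by linarith
            qed
          qed
        qed (rule triv)
        then show ?thesis using d1 d2 by (intro exI[of _ "min d1 d2"]) auto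
      next
        case True
        obtain C d1 where d1: "d1 > 0" "\<And>u v. p \<le> u \<and> u \<le> x \<and> x \<le> v \<and> v \<le> q \<and> u < v \<and> v - u < d1
            \<longrightarrow> (\<forall>\<^sub>F n in sequentially. \<bar>N n u v\<bar> \<le> C * (v - u))"
        proof -
          have "x \<in> {p..q} \<inter> S" using x True by simp
          from sing[OF this] show thesis using that by blast
        qed
        \<comment> \<open>\<open>K\<close> covers the bound \<open>C\<close> for the counts and the
          bound \<open>B\<close> for \<open>g\<close>. With \<open>d \<le> (e / K)^2\<close>,
          splitting \<open>v - u\<close> at \<open>x\<close> gives
          \<open>v - u \<le> sqrt (v - u) * (sqrt (v - x) + sqrt (x - u))\<close>, hence
          \<open>K * (v - u)\<close> is at most \<open>e\<close> times the increment of
          \<open>\<tau>\<close>.\<close>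
        define K where "K = \<bar>C\<bar> + \<bar>B\<bar> + 1"
        define d where "d = min d1 ((e / K)\<^sup>2)"
        have "K > 0" by (simp add: K_def)
        then have "d > 0" using e d1 by (simp add: d_def)
        have "P u v" if uv: "u \<le> x" "x \<le> v" "v - u < d" for u v
        proof (cases "u = v")
          case ne: False
          show ?thesis unfolding P_def
          proof (intro impI)
            assume b: "p \<le> u" "u \<le> v" "v \<le> q"
            have I: "\<bar>integral {u..v} g\<bar> \<le> B * (v - u)"
            proof -
              have gB: "\<bar>g z\<bar> \<le> B" if "z \<in> {u..v}" for z
                using that b bdd[of z] by auto
              have "integral {u..v} g \<le> integral {u..v} (\<lambda>_. B)"
                by (rule integral_le[OF int'[OF b(1,3)] integrable_const_ivl]) (drule gB, linarith)
              moreover have "integral {u..v} g \<ge> integral {u..v} (\<lambda>_. - B)"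
                by (rule integral_le[OF integrable_const_ivl int'[OF b(1,3)]]) (drule gB, linarith)
              moreover have "integral {u..v} (\<lambda>_. B) = B * (v - u)" "integral {u..v} (\<lambda>_. - B) = - (B * (v - u))"
                using b by (simp_all add: mult.commute)
              ultimately show ?thesis by linarith
            qed
            have "sqrt (v - u) \<le> sqrt ((e / K)\<^sup>2)" using uv by (intro real_sqrt_le_mono) (simp add: d_def)
            then have sq: "sqrt (v - u) \<le> e / K" using e \<open>K > 0\<close> by simp
            have part: "z \<le> sqrt (v - u) * sqrt z" if "0 \<le> z" "z \<le> v - u" for z
            proof -
              have "z = sqrt z * sqrt z" using that by simp
              also have "\<dots> \<le> sqrt (v - u) * sqrt z" using that by (intro mult_right_mono real_sqrt_le_mono) auto
              finally show ?thesis .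
            qed
            have "v - u = (v - x) + (x - u)" by simp
            also have "\<dots> \<le> sqrt (v - u) * (sqrt (v - x) + sqrt (x - u))"
              using part[of "v - x"] part[of "x - u"] uv by (simp add: distrib_left)
            also have "\<dots> \<le> e / K * (\<tau> v - \<tau> u)"
              using sq \<tau>_ge[OF True uv(1,2)] uv e \<open>K > 0\<close> by (intro mult_mono) auto
            finally have vu: "K * (v - u) \<le> e * (\<tau> v - \<tau> u)" using \<open>K > 0\<close> by (simp add: field_simps)
            have "\<forall>\<^sub>F n in sequentially. \<bar>N n u v\<bar> \<le> C * (v - u)"
              using d1(2)[of u v] uv b ne by (auto simp: d_def)
            then show "\<forall>\<^sub>F n in sequentially. \<bar>N n u v - integral {u..v} g\<bar> \<le> e * (v - u) + e * (\<tau> v - \<tau> u)"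
            proof eventually_elim
              case (elim n)
              have "C * (v - u) + B * (v - u) \<le> K * (v - u)"
                unfolding distrib_right[symmetric] using b by (intro mult_right_mono) (auto simp: K_def)
              moreover have "0 \<le> e * (v - u)" using e b by simp
              ultimately show ?case using elim I vu by linarith
            qed
          qed
        qed (rule triv)
        then show ?thesis using \<open>d > 0\<close> by blast
      qed
    qed
    then show ?thesis using assms(1) by (simp add: P_def)
  qed
  show ?thesis
  proof (rule tendstoI)
    fix e :: real assume "e > 0"
    define L where "L = q - p + (\<tau> q - \<tau> p) + 1"
    have "L > 0" using \<tau>_mono[OF assms(1)] assms(1) by (simp add: L_def)
    have "\<forall>\<^sub>F n in sequentially. \<bar>N n p q - integral {p..q} g\<bar> \<le> e / L * (q - p) + e / L * (\<tau> q - \<tau> p)"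
      using \<open>e > 0\<close> \<open>L > 0\<close> by (intro main) simp
    then show "\<forall>\<^sub>F n in sequentially. dist (N n p q) (integral {p..q} g) < e"
    proof eventually_elim
      case (elim n)
      have "e / L * (q - p) + e / L * (\<tau> q - \<tau> p) = e / L * (L - 1)"
        unfolding distrib_left[symmetric] by (simp add: L_def)
      also have "\<dots> < e" using \<open>e > 0\<close> \<open>L > 0\<close> by (simp add: field_simps)
      finally show ?case using elim by (simp add: dist_real_def)
    qed
  qed
qed

section \<open>Asymptotic zero counts\<close>

text \<open>Reduces an interval that ends at a singular point to one that begins there, the
  situation of \<open>zero_spacing_singular\<close>.\<close>

lemma (in sturm_equation) sturm_equation_reflect:
  "sturm_equation (\<lambda>x. w (- x)) (\<lambda>x. - w' (- x)) (\<lambda>x. F (- x)) (- b) (- a)"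
proof
  fix x assume x: "- b < x" "x < - a"
  show "((\<lambda>x. w (- x)) has_real_derivative - w' (- x)) (at x)"
    using DERIV_chain2[where f = w and g = uminus, OF dw DERIV_minus[OF DERIV_ident]] x by simp
  show "((\<lambda>x. - w' (- x)) has_real_derivative - F (- x) * w (- x)) (at x)"
    using DERIV_minus[OF DERIV_chain2[where f = w' and g = uminus, OF dw' DERIV_minus[OF DERIV_ident]]] x by simp
qed

lemma sin_double_multiple_nonzero:
  fixes \<theta> :: real
  assumes "sin (2 * real k * \<theta>) \<noteq> 0"
  shows "sin \<theta> \<noteq> 0" "sin (real k * \<theta>) \<noteq> 0" "cos (real k * \<theta>) \<noteq> 0"
proof -
  show "sin (real k * \<theta>) \<noteq> 0" "cos (real k * \<theta>) \<noteq> 0"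
    using assms sin_double[of "real k * \<theta>"] by (auto simp: mult.assoc)
  show "sin \<theta> \<noteq> 0"
  proof
    assume "sin \<theta> = 0"
    \<comment> \<open>The point is that \<open>sin (2 k \<theta>)\<close> equals
      \<open>sin \<theta>\<close> times the value of \<open>cheb_U (2 * k - 1)\<close> at
      \<open>cos \<theta>\<close>.\<close>
    then have "sin \<theta> * poly (cheb_U n) (cos \<theta>) = 0" for n by simp
    then have "sin (real (Suc n) * \<theta>) = 0" for n unfolding poly_cheb_U_cos by simp
    from this[of "2 * k - 1"] show False using assms by (cases k) simp_all
  qed
qed

lemma finite_sin_zeros:
  assumes "m > 0"
  shows "finite {\<theta>::real. 0 \<le> \<theta> \<and> \<theta> \<le> pi \<and> sin (real m * \<theta>) = 0}"
proof (rule finite_subset)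
  show "{\<theta>::real. 0 \<le> \<theta> \<and> \<theta> \<le> pi \<and> sin (real m * \<theta>) = 0} \<subseteq> (\<lambda>i::int. of_int i * pi / real m) ` {0..int m}"
  proof
    fix \<theta> :: real assume t: "\<theta> \<in> {\<theta>. 0 \<le> \<theta> \<and> \<theta> \<le> pi \<and> sin (real m * \<theta>) = 0}"
    then obtain i :: int where i: "real m * \<theta> = of_int i * pi" by (auto simp: sin_zero_iff_int2)
    then have "\<theta> = of_int i * pi / real m" using assms by (simp add: field_simps)
    moreover have "0 \<le> of_int i * pi" "of_int i * pi \<le> real m * pi"
      unfolding i[symmetric] using t assms by auto
    then have "i \<in> {0..int m}" using pi_gt_zero by (simp add: zero_le_mult_iff mult_le_cancel_right)
    ultimately show "\<theta> \<in> (\<lambda>i::int. of_int i * pi / real m) ` {0..int m}" by blast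
  qed
qed simp

text \<open>The \<open>F\<close> of \<open>gegenbauer_liouville\<close> with its three coefficients
  as parameters, so that the scaled limit is the same formula with limiting coefficients.\<close>

definition potential :: "real \<Rightarrow> real \<Rightarrow> real \<Rightarrow> real \<Rightarrow> real \<Rightarrow> real" where
  "potential \<kappa> A B C \<theta> = \<kappa>\<^sup>2 * (A + B / (sin (\<kappa> * \<theta>))\<^sup>2 + C / (cos (\<kappa> * \<theta>))\<^sup>2)"

text \<open>The degree \<open>M n * k\<close> is an even multiple of \<open>k\<close>, so that only the even case of the
  generalized Gegenbauer equation is needed.\<close>

locale sieved_zeros =
  fixes k :: nat and \<alpha> \<gamma> :: "nat \<Rightarrow> real" and M :: "nat \<Rightarrow> nat" and a c :: real
  assumes k: "k \<ge> 1" and \<alpha>: "\<And>n. \<alpha> n > -1/2" and \<gamma>: "\<And>n. \<gamma> n > -1" and M: "\<And>n. even (M n)"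
    and \<alpha>_lim: "(\<lambda>n. \<alpha> n / real n) \<longlonglongrightarrow> a" and \<gamma>_lim: "(\<lambda>n. \<gamma> n / real n) \<longlonglongrightarrow> c"
    and M_lim: "(\<lambda>n. real (M n) / real n) \<longlonglongrightarrow> 1"
begin

definition zeros :: "nat \<Rightarrow> real set \<Rightarrow> real set" where
  "zeros n A = {\<theta> \<in> A. poly (sieved_C k (\<alpha> n) (\<gamma> n) (M n * k)) (cos \<theta>) = 0}"

definition pot :: "nat \<Rightarrow> real \<Rightarrow> real" where
  "pot n = potential (real k) ((real (M n) + \<alpha> n + \<gamma> n / 2)\<^sup>2) (\<alpha> n - (\<alpha> n)\<^sup>2) (\<gamma> n / 2 - (\<gamma> n)\<^sup>2 / 4)"

text \<open>The limit of \<open>pot n / n^2\<close>: in the singular coefficients the linear terms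
  \<open>\<alpha> n\<close> and \<open>\<gamma> n / 2\<close> disappear and only the negative
  squares remain.\<close>

definition lim_pot :: "real \<Rightarrow> real" where
  "lim_pot = potential (real k) ((1 + a + c / 2)\<^sup>2) (- a\<^sup>2) (- c\<^sup>2 / 4)"

lemma finite_zeros: "A \<subseteq> {0..pi} \<Longrightarrow> finite (zeros n A)"
proof -
  assume A: "A \<subseteq> {0..pi}"
  have "finite {x. poly (sieved_C k (\<alpha> n) (\<gamma> n) (M n * k)) x = 0}"
    using sieved_C_nonzero[OF k \<alpha> \<gamma>] poly_roots_finite by blast
  moreover have "cos ` zeros n A \<subseteq> {x. poly (sieved_C k (\<alpha> n) (\<gamma> n) (M n * k)) x = 0}"
    by (auto simp: zeros_def)
  moreover have "inj_on cos (zeros n A)"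
  proof (rule inj_on_subset)
    show "inj_on cos {0..pi}" by (rule inj_onI) (simp add: cos_inj_pi)
    show "zeros n A \<subseteq> {0..pi}" using A by (auto simp: zeros_def)
  qed
  ultimately show ?thesis by (metis finite_imageD finite_subset)
qed

lemma sturm_equation_zeros:
  assumes "\<And>\<theta>. p < \<theta> \<Longrightarrow> \<theta> < q \<Longrightarrow> sin (2 * real k * \<theta>) \<noteq> 0"
  obtains w w' where "sturm_equation w w' (pot n) p q"
    "\<And>\<theta>. p < \<theta> \<Longrightarrow> \<theta> < q \<Longrightarrow> w \<theta> = 0 \<longleftrightarrow> \<theta> \<in> zeros n UNIV"
proof -
  obtain w w' :: "real \<Rightarrow> real" where w:
    "\<And>\<theta>. w \<theta> = 0 \<longleftrightarrow> poly (sieved_C 1 (\<alpha> n) (\<gamma> n) (M n)) (cos (real k * \<theta>)) = 0"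
    "\<And>\<theta>. sin (2 * real k * \<theta>) \<noteq> 0 \<Longrightarrow> (w has_real_derivative w' \<theta>) (at \<theta>)"
    "\<And>\<theta>. sin (2 * real k * \<theta>) \<noteq> 0 \<Longrightarrow> (w' has_real_derivative - pot n \<theta> * w \<theta>) (at \<theta>)"
    using gegenbauer_liouville[OF \<alpha>[of n] \<gamma>[of n] M[of n], of "real k"] unfolding pot_def potential_def by metis
  show ?thesis
  proof
    show "sturm_equation w w' (pot n) p q" by unfold_locales (use w assms in auto)
    show "w \<theta> = 0 \<longleftrightarrow> \<theta> \<in> zeros n UNIV" if "p < \<theta>" "\<theta> < q" for \<theta>
      using sin_double_multiple_nonzero(1)[OF assms[OF that]] sieved_C_eq_gegenbauer[OF k \<alpha> \<gamma>, of \<theta> n n "M n"]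
      by (simp add: w(1) zeros_def)
  qed
qed

lemma coefficient_limits:
  "(\<lambda>n. (real (M n) + \<alpha> n + \<gamma> n / 2)\<^sup>2 / (real n)\<^sup>2) \<longlonglongrightarrow> (1 + a + c / 2)\<^sup>2"
  "(\<lambda>n. (\<alpha> n - (\<alpha> n)\<^sup>2) / (real n)\<^sup>2) \<longlonglongrightarrow> - a\<^sup>2"
  "(\<lambda>n. (\<gamma> n / 2 - (\<gamma> n)\<^sup>2 / 4) / (real n)\<^sup>2) \<longlonglongrightarrow> - c\<^sup>2 / 4"
proof -
  have "(\<lambda>n. (real (M n) / real n + \<alpha> n / real n + \<gamma> n / real n / 2)\<^sup>2) \<longlonglongrightarrow> (1 + a + c / 2)\<^sup>2"
    by (intro tendsto_intros M_lim \<alpha>_lim \<gamma>_lim) simp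
  then show "(\<lambda>n. (real (M n) + \<alpha> n + \<gamma> n / 2)\<^sup>2 / (real n)\<^sup>2) \<longlonglongrightarrow> (1 + a + c / 2)\<^sup>2"
    by (simp add: power_divide[symmetric] add_divide_distrib mult.commute)
  have "(\<lambda>n. \<alpha> n / real n * (1 / real n) - (\<alpha> n / real n)\<^sup>2) \<longlonglongrightarrow> a * 0 - a\<^sup>2"
    by (intro tendsto_intros \<alpha>_lim lim_1_over_n)
  then show "(\<lambda>n. (\<alpha> n - (\<alpha> n)\<^sup>2) / (real n)\<^sup>2) \<longlonglongrightarrow> - a\<^sup>2"
    by (simp add: power_divide diff_divide_distrib power2_eq_square)
  have "(\<lambda>n. \<gamma> n / real n * (1 / real n) / 2 - (\<gamma> n / real n)\<^sup>2 / 4) \<longlonglongrightarrow> c * 0 / 2 - c\<^sup>2 / 4"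
    by (intro tendsto_intros \<gamma>_lim lim_1_over_n) auto
  then show "(\<lambda>n. (\<gamma> n / 2 - (\<gamma> n)\<^sup>2 / 4) / (real n)\<^sup>2) \<longlonglongrightarrow> - c\<^sup>2 / 4"
    by (simp add: power_divide diff_divide_distrib power2_eq_square mult_ac)
qed

text \<open>The limit is joint in \<open>n\<close> and \<open>\<theta>\<close>. This yields bounds
  uniform on a neighbourhood of \<open>x\<close>, which a Sturm comparison over a whole interval
  requires.\<close>

lemma tendsto_pot:
  assumes "sin (2 * real k * x) \<noteq> 0"
  shows "((\<lambda>(n, \<theta>). pot n \<theta> / (real n)\<^sup>2) \<longlongrightarrow> lim_pot x) (sequentially \<times>\<^sub>F nhds x)"
proof -
  note nz = sin_double_multiple_nonzero[OF assms]
  have fst: "((\<lambda>z. h (fst z)) \<longlongrightarrow> l) (sequentially \<times>\<^sub>F nhds x)" if "h \<longlonglongrightarrow> l" for h :: "nat \<Rightarrow> real" and l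
    using that by (rule filterlim_compose) (rule filterlim_fst)
  have snd: "((\<lambda>z. snd z) \<longlongrightarrow> x) (sequentially \<times>\<^sub>F nhds x)" by (rule filterlim_snd)
  have "((\<lambda>z. (real k)\<^sup>2 * ((real (M (fst z)) + \<alpha> (fst z) + \<gamma> (fst z) / 2)\<^sup>2 / (real (fst z))\<^sup>2
      + (\<alpha> (fst z) - (\<alpha> (fst z))\<^sup>2) / (real (fst z))\<^sup>2 / (sin (real k * snd z))\<^sup>2
      + (\<gamma> (fst z) / 2 - (\<gamma> (fst z))\<^sup>2 / 4) / (real (fst z))\<^sup>2 / (cos (real k * snd z))\<^sup>2)) \<longlongrightarrow> lim_pot x)
     (sequentially \<times>\<^sub>F nhds x)"
    unfolding lim_pot_def potential_def
    using nz by (intro tendsto_intros snd fst[OF coefficient_limits(1)] fst[OF coefficient_limits(2)] fst[OF coefficient_limits(3)]) auto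
  moreover have "K * (A / r + B / r / s + C / r / t) = K * (A + B / s + C / t) / r" for K A B C r s t :: real
    by (simp add: add_divide_distrib distrib_left mult.commute)
  ultimately show ?thesis
    by (simp only: pot_def potential_def case_prod_unfold)
qed

lemma pot_near:
  assumes "sin (2 * real k * x) \<noteq> 0" "e > 0"
  shows "\<exists>d>0. \<forall>\<^sub>F n in sequentially. \<forall>\<theta>. \<bar>\<theta> - x\<bar> < d \<longrightarrow> \<bar>pot n \<theta> / (real n)\<^sup>2 - lim_pot x\<bar> < e"
proof -
  have "\<forall>\<^sub>F z in sequentially \<times>\<^sub>F nhds x. dist (case z of (n, \<theta>) \<Rightarrow> pot n \<theta> / (real n)\<^sup>2) (lim_pot x) < e"
    using tendstoD[OF tendsto_pot[OF assms(1)] assms(2)] .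
  then obtain P Q where PQ: "eventually P sequentially" "eventually Q (nhds x)"
    "\<And>n \<theta>. P n \<Longrightarrow> Q \<theta> \<Longrightarrow> dist (pot n \<theta> / (real n)\<^sup>2) (lim_pot x) < e"
    unfolding eventually_prod_filter by auto
  obtain d where d: "d > 0" "\<And>y. dist y x < d \<Longrightarrow> Q y" using PQ(2) unfolding eventually_nhds_metric by auto
  have "\<forall>\<^sub>F n in sequentially. \<forall>\<theta>. \<bar>\<theta> - x\<bar> < d \<longrightarrow> \<bar>pot n \<theta> / (real n)\<^sup>2 - lim_pot x\<bar> < e"
    using PQ(1) by eventually_elim (use d PQ(3) in \<open>auto simp: dist_real_def\<close>)
  then show ?thesis using d(1) by blast
qed

end

text \<open>Since \<open>1 / sin^2 = 1 + cot^2\<close>, this is \<open>y \<le> tan y\<close> in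
  disguise. The coefficient 1 of \<open>1 / y^2\<close> must not be larger, because the comparison
  below is at the critical size; the bounded remainder 1 is absorbed into
  \<open>m^2\<close>.\<close>

lemma inverse_sin_squared_le:
  fixes y :: real
  assumes "y \<noteq> 0" "\<bar>y\<bar> < pi / 2"
  shows "1 / (sin y)\<^sup>2 \<le> 1 / y\<^sup>2 + 1"
proof -
  define z where "z = \<bar>y\<bar>"
  have z: "0 < z" "z < pi / 2" using assms by (auto simp: z_def)
  have "z * cos z \<le> sin z"
  proof -
    have "0 * cos 0 - sin 0 \<ge> z * cos z - sin z"
    proof (rule DERIV_nonpos_imp_nonincreasing[of 0 z "\<lambda>x. x * cos x - sin x"])
      fix x assume x: "0 \<le> x" "x \<le> z"
      have "((\<lambda>x. x * cos x - sin x) has_real_derivative - x * sin x) (at x)"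
        by (auto intro!: derivative_eq_intros simp: algebra_simps)
      moreover have "- x * sin x \<le> 0" using x z by (simp add: sin_ge_zero)
      ultimately show "\<exists>y. ((\<lambda>x. x * cos x - sin x) has_real_derivative y) (at x) \<and> y \<le> 0" by blast
    qed (use z in simp)
    then show ?thesis by simp
  qed
  then have "(z * cos z)\<^sup>2 \<le> (sin z)\<^sup>2"
    using z cos_gt_zero_pi[of z] by (intro power_mono) auto
  then have "z\<^sup>2 \<le> (sin z)\<^sup>2 * (1 + z\<^sup>2)" by (simp add: power_mult_distrib cos_squared_eq algebra_simps)
  moreover have "sin z > 0" using z by (intro sin_gt_zero) auto
  ultimately have "1 / (sin z)\<^sup>2 \<le> 1 / z\<^sup>2 + 1" using z by (simp add: field_simps)
  moreover have "(sin z)\<^sup>2 = (sin y)\<^sup>2" "z\<^sup>2 = y\<^sup>2" by (auto simp: z_def abs_if)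
  ultimately show ?thesis by simp
qed

section \<open>Zero counts on short intervals around regular and singular points\<close>

context sieved_zeros
begin

lemma card_zeros_le:
  assumes "0 \<le> p" "q \<le> pi" "p < u" "u \<le> v" "v \<le> q" "m > 0"
    and "\<And>\<theta>. p < \<theta> \<Longrightarrow> \<theta> < q \<Longrightarrow> sin (2 * real k * \<theta>) \<noteq> 0"
    and "\<And>\<theta>. p < \<theta> \<Longrightarrow> \<theta> < q \<Longrightarrow> pot n \<theta> < m\<^sup>2"
  shows "real (card (zeros n {u..<v})) \<le> (v - u) * m / pi + 1"
proof -
  obtain w w' where w: "sturm_equation w w' (pot n) p q"
    "\<And>\<theta>. p < \<theta> \<Longrightarrow> \<theta> < q \<Longrightarrow> w \<theta> = 0 \<longleftrightarrow> \<theta> \<in> zeros n UNIV"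
    using sturm_equation_zeros[OF assms(7)] by metis
  interpret sturm_equation w w' "pot n" p q by (rule w(1))
  have "{x. p < x \<and> x < q \<and> w x = 0} \<subseteq> zeros n {0..pi}"
    using w(2) assms(1,2) by (fastforce simp: zeros_def)
  then have fin: "finite {x. p < x \<and> x < q \<and> w x = 0}" using finite_zeros finite_subset by blast
  have "real (card (zeros n {u..<v})) \<le> (v - u) / (pi / m) + 1"
  proof (rule card_le_if_spaced)
    fix s t assume st: "s \<in> zeros n {u..<v}" "t \<in> zeros n {u..<v}" "s < t"
    have s: "p < s" "s < q" "s \<in> zeros n UNIV" and t: "p < t" "t < q" "t \<in> zeros n UNIV"
      using st assms(3,5) by (auto simp: zeros_def)
    show "t - s \<ge> pi / m"
      using s t w(2) assms(6,8) st(3) fin by (intro zero_spacing) auto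
  qed (use assms in \<open>auto simp: zeros_def\<close>)
  then show ?thesis by simp
qed

lemma card_zeros_ge:
  assumes "0 \<le> p" "q \<le> pi" "p < u" "u \<le> v" "v < q" "m > 0"
    and "\<And>\<theta>. p < \<theta> \<Longrightarrow> \<theta> < q \<Longrightarrow> sin (2 * real k * \<theta>) \<noteq> 0"
    and "\<And>\<theta>. p < \<theta> \<Longrightarrow> \<theta> < q \<Longrightarrow> pot n \<theta> > m\<^sup>2"
  shows "real (card (zeros n {u..<v})) \<ge> (v - u) * m / pi - 1"
proof -
  obtain w w' where w: "sturm_equation w w' (pot n) p q"
    "\<And>\<theta>. p < \<theta> \<Longrightarrow> \<theta> < q \<Longrightarrow> w \<theta> = 0 \<longleftrightarrow> \<theta> \<in> zeros n UNIV"
    using sturm_equation_zeros[OF assms(7)] by metis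
  interpret sturm_equation w w' "pot n" p q by (rule w(1))
  have "real (card (zeros n {u..<v})) \<ge> (v - u) / (pi / m) - 1"
  proof (rule card_ge_if_dense)
    show "finite (zeros n {u..<v})" by (rule finite_zeros) (use assms in auto)
    fix s assume s: "u \<le> s" "s + pi / m \<le> v"
    have "\<exists>x. s < x \<and> x < s + pi / m \<and> w x = 0"
      by (rule zero_between) (use s assms in auto)
    then obtain x where x: "s < x" "x < s + pi / m" "w x = 0" by blast
    then have "x \<in> zeros n UNIV" using w(2)[of x] s assms by auto
    then have "x \<in> zeros n {u..<v}" using x s by (auto simp: zeros_def)
    then show "\<exists>x\<in>zeros n {u..<v}. s < x \<and> x < s + pi / m" using x by blast
  qed (use assms in auto)
  then show ?thesis by simp
qed

lemma card_zeros_singular_right: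
  assumes "0 \<le> p" "q \<le> pi" "p < q" "m > 0"
    and "\<And>\<theta>. p < \<theta> \<Longrightarrow> \<theta> < q \<Longrightarrow> sin (2 * real k * \<theta>) \<noteq> 0"
    and "\<And>\<theta>. p < \<theta> \<Longrightarrow> \<theta> < q \<Longrightarrow> pot n \<theta> < m\<^sup>2 + 1 / (4 * (\<theta> - p)\<^sup>2)"
  shows "real (card (zeros n {p<..<q})) \<le> (q - p) * (2 * m / pi) + 1"
proof -
  obtain w w' where w: "sturm_equation w w' (pot n) p q"
    "\<And>\<theta>. p < \<theta> \<Longrightarrow> \<theta> < q \<Longrightarrow> w \<theta> = 0 \<longleftrightarrow> \<theta> \<in> zeros n UNIV"
    using sturm_equation_zeros[OF assms(5)] by metis
  interpret sturm_equation w w' "pot n" p q by (rule w(1))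
  have "{x. p < x \<and> x < q \<and> w x = 0} \<subseteq> zeros n {0..pi}"
    using w(2) assms(1,2) by (fastforce simp: zeros_def)
  then have fin: "finite {x. p < x \<and> x < q \<and> w x = 0}" using finite_zeros finite_subset by blast
  have "real (card (zeros n {p<..<q})) \<le> (q - p) / (pi / (2 * m)) + 1"
  proof (rule card_le_if_spaced)
    fix s t assume st: "s \<in> zeros n {p<..<q}" "t \<in> zeros n {p<..<q}" "s < t"
    have s: "p < s" "s < q" "s \<in> zeros n UNIV" and t: "p < t" "t < q" "t \<in> zeros n UNIV"
      using st by (auto simp: zeros_def)
    show "t - s \<ge> pi / (2 * m)"
      using s t w(2) assms(4,6) st(3) fin by (intro zero_spacing_singular) auto
  qed (use assms in \<open>auto simp: zeros_def\<close>)
  then show ?thesis by simp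
qed

lemma card_zeros_singular_left:
  assumes "0 \<le> p" "q \<le> pi" "p < q" "m > 0"
    and "\<And>\<theta>. p < \<theta> \<Longrightarrow> \<theta> < q \<Longrightarrow> sin (2 * real k * \<theta>) \<noteq> 0"
    and "\<And>\<theta>. p < \<theta> \<Longrightarrow> \<theta> < q \<Longrightarrow> pot n \<theta> < m\<^sup>2 + 1 / (4 * (q - \<theta>)\<^sup>2)"
  shows "real (card (zeros n {p<..<q})) \<le> (q - p) * (2 * m / pi) + 1"
proof -
  obtain w w' where w: "sturm_equation w w' (pot n) p q"
    "\<And>\<theta>. p < \<theta> \<Longrightarrow> \<theta> < q \<Longrightarrow> w \<theta> = 0 \<longleftrightarrow> \<theta> \<in> zeros n UNIV"
    using sturm_equation_zeros[OF assms(5)] by metis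
  interpret R: sturm_equation "\<lambda>x. w (- x)" "\<lambda>x. - w' (- x)" "\<lambda>x. pot n (- x)" "- q" "- p"
    by (rule sturm_equation.sturm_equation_reflect[OF w(1)])
  have "{x. - q < x \<and> x < - p \<and> w (- x) = 0} \<subseteq> uminus ` zeros n {0..pi}"
  proof
    fix x assume x: "x \<in> {x. - q < x \<and> x < - p \<and> w (- x) = 0}"
    then have "- x \<in> zeros n {0..pi}" using w(2)[of "- x"] assms(1,2) by (auto simp: zeros_def)
    then show "x \<in> uminus ` zeros n {0..pi}" by (rule rev_image_eqI) simp
  qed
  then have fin: "finite {x. - q < x \<and> x < - p \<and> w (- x) = 0}"
    using finite_zeros finite_subset by blast
  have "real (card (zeros n {p<..<q})) \<le> (q - p) / (pi / (2 * m)) + 1"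
  proof (rule card_le_if_spaced)
    fix s t assume st: "s \<in> zeros n {p<..<q}" "t \<in> zeros n {p<..<q}" "s < t"
    have s: "p < s" "s < q" "s \<in> zeros n UNIV" and t: "p < t" "t < q" "t \<in> zeros n UNIV"
      using st by (auto simp: zeros_def)
    have "pi / (2 * m) \<le> - s - - t"
    proof (rule R.zero_spacing_singular)
      fix x assume "- q < x" "x < - p"
      then show "pot n (- x) < m\<^sup>2 + 1 / (4 * (x - - q)\<^sup>2)"
        using assms(6)[of "- x"] by (simp add: add.commute)
    qed (use s t w(2) assms(4) st(3) fin in auto)
    then show "t - s \<ge> pi / (2 * m)" by simp
  qed (use assms in \<open>auto simp: zeros_def\<close>)
  then show ?thesis by simp
qed

lemma eventually_const_divide_le:
  fixes C e :: real
  assumes "e > 0"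
  shows "\<forall>\<^sub>F n in sequentially. C / real n \<le> e"
  using order_tendstoD(2)[OF lim_const_over_n[of C] assms] by (rule eventually_mono) simp

text \<open>Near \<open>x\<close> the potential lies below \<open>(n * (s + e'))^2\<close> and, when
  \<open>s > e'\<close>, above \<open>(n * (s - e'))^2\<close>; the two comparisons count zeros up
  to one each, an error that dividing by \<open>n\<close> removes.\<close>

lemma zeros_regular:
  assumes x: "x \<in> {0..pi}" "sin (2 * real k * x) \<noteq> 0" and e: "e > 0"
  shows "\<exists>d>0. \<forall>u v. 0 \<le> u \<and> u \<le> x \<and> x \<le> v \<and> v \<le> pi \<and> u < v \<and> v - u < d \<longrightarrow>
    (\<forall>\<^sub>F n in sequentially. \<bar>real (card (zeros n {u..<v})) / real n - sqrt (max (lim_pot x) 0) / pi * (v - u)\<bar> \<le> e * (v - u))"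
proof -
  have "sin (2 * real k * pi) = 0" using sin_npi2[of "2 * k"] by (simp add: mult.commute)
  then have "x \<noteq> 0" "x \<noteq> pi" using x(2) by auto
  then have x0: "0 < x" "x < pi" using x(1) by auto
  have "isCont (\<lambda>x. sin (2 * real k * x)) x" by (intro continuous_intros)
  then obtain d0 where d0: "d0 > 0" "\<And>\<theta>. dist \<theta> x < d0 \<Longrightarrow> dist (sin (2 * real k * \<theta>)) (sin (2 * real k * x)) < \<bar>sin (2 * real k * x)\<bar>"
    unfolding continuous_at_eps_delta using x(2) by (metis zero_less_abs_iff)
  have nz: "sin (2 * real k * \<theta>) \<noteq> 0" if "\<bar>\<theta> - x\<bar> < d0" for \<theta>
    using d0(2)[of \<theta>] that by (auto simp: dist_real_def)
  \<comment> \<open>A frequency error \<open>e'\<close> changes the density by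
    \<open>e' / pi = e / 2\<close>; the other half of \<open>e\<close> pays for the 1 in the
    counting bounds.\<close>
  define e' where "e' = e * pi / 2"
  have e': "e' > 0" using e by (simp add: e'_def)
  define s where "s = sqrt (max (lim_pot x) 0)"
  have s: "s \<ge> 0" "s\<^sup>2 = max (lim_pot x) 0" by (auto simp: s_def)
  \<comment> \<open>Closeness \<open>e'^2\<close> is chosen because
    \<open>s^2 + e'^2 \<le> (s + e')^2\<close>, and \<open>(s - e')^2 < s^2 - e'^2\<close> when
    \<open>s > e'\<close>.\<close>
  obtain d1 where d1: "d1 > 0" "\<forall>\<^sub>F n in sequentially. \<forall>\<theta>. \<bar>\<theta> - x\<bar> < d1 \<longrightarrow> \<bar>pot n \<theta> / (real n)\<^sup>2 - lim_pot x\<bar> < e'\<^sup>2"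
    using pot_near[OF x(2), of "e'\<^sup>2"] e' by auto
  define d where "d = min (min d0 d1) (min x (pi - x))"
  have "d > 0" using d0 d1 x0 by (simp add: d_def)
  show ?thesis
  proof (intro exI[of _ d] conjI allI impI \<open>d > 0\<close>)
    fix u v assume uv: "0 \<le> u \<and> u \<le> x \<and> x \<le> v \<and> v \<le> pi \<and> u < v \<and> v - u < d"
    have "\<forall>\<^sub>F n in sequentially. 1 / real n \<le> e / 2 * (v - u)"
      using uv e by (intro eventually_const_divide_le) auto
    then show "\<forall>\<^sub>F n in sequentially. \<bar>real (card (zeros n {u..<v})) / real n - sqrt (max (lim_pot x) 0) / pi * (v - u)\<bar> \<le> e * (v - u)"
      using d1(2) eventually_gt_at_top[of 0]
    proof eventually_elim
      case (elim n)
      have n: "real n > 0" using elim by simp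
      have pq: "0 \<le> x - d" "x + d \<le> pi" "x - d < u" "u \<le> v" "v \<le> x + d" "v < x + d"
        using uv \<open>d > 0\<close> by (auto simp: d_def)
      have near: "\<bar>\<theta> - x\<bar> < d0" "\<bar>\<theta> - x\<bar> < d1" if "x - d < \<theta>" "\<theta> < x + d" for \<theta>
        using that by (auto simp: d_def)
      have "real (card (zeros n {u..<v})) \<le> (v - u) * (real n * (s + e')) / pi + 1"
      proof (rule card_zeros_le[OF pq(1-5)])
        show "0 < real n * (s + e')" using n s e' by (intro mult_pos_pos) auto
        fix \<theta> assume \<theta>: "x - d < \<theta>" "\<theta> < x + d"
        show "sin (2 * real k * \<theta>) \<noteq> 0" using nz near[OF \<theta>] by blast
        have "pot n \<theta> / (real n)\<^sup>2 < s\<^sup>2 + e'\<^sup>2" using elim(2) near[OF \<theta>] s(2) by fastforce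
        also have "\<dots> \<le> (s + e')\<^sup>2" using s(1) e' by (simp add: power2_sum)
        finally show "pot n \<theta> < (real n * (s + e'))\<^sup>2"
          using n by (simp add: power_mult_distrib pos_divide_less_eq mult.commute)
      qed
      then have "real (card (zeros n {u..<v})) / real n \<le> ((v - u) * (real n * (s + e')) / pi + 1) / real n"
        by (rule divide_right_mono) simp
      also have "\<dots> = s / pi * (v - u) + e / 2 * (v - u) + 1 / real n"
        using n by (simp add: e'_def field_simps)
      finally have up: "real (card (zeros n {u..<v})) / real n \<le> s / pi * (v - u) + e / 2 * (v - u) + 1 / real n" .
      have lo: "s / pi * (v - u) - e / 2 * (v - u) - 1 / real n \<le> real (card (zeros n {u..<v})) / real n"
      proof (cases "s > e'")
        case True
        have "real (card (zeros n {u..<v})) \<ge> (v - u) * (real n * (s - e')) / pi - 1"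
        proof (rule card_zeros_ge[OF pq(1-4,6)])
          show "0 < real n * (s - e')" using n True by (intro mult_pos_pos) auto
          fix \<theta> assume \<theta>: "x - d < \<theta>" "\<theta> < x + d"
          show "sin (2 * real k * \<theta>) \<noteq> 0" using nz near[OF \<theta>] by blast
          have "(s - e')\<^sup>2 < (s - e') * (s + e')"
            unfolding power2_eq_square using True e' by (intro mult_strict_left_mono) auto
          also have "\<dots> = s\<^sup>2 - e'\<^sup>2" by (simp add: power2_eq_square algebra_simps)
          also have "s\<^sup>2 = lim_pot x" using True e' s by (auto simp: max_def split: if_splits)
          finally have "(s - e')\<^sup>2 < lim_pot x - e'\<^sup>2" .
          also have "\<dots> < pot n \<theta> / (real n)\<^sup>2" using elim(2) near[OF \<theta>] by fastforce
          finally show "(real n * (s - e'))\<^sup>2 < pot n \<theta>"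
            using n by (simp add: power_mult_distrib pos_less_divide_eq mult.commute)
        qed
        then have "((v - u) * (real n * (s - e')) / pi - 1) / real n \<le> real (card (zeros n {u..<v})) / real n"
          by (rule divide_right_mono) simp
        moreover have "((v - u) * (real n * (s - e')) / pi - 1) / real n = s / pi * (v - u) - e / 2 * (v - u) - 1 / real n"
          using n by (simp add: e'_def field_simps)
        ultimately show ?thesis by simp
      next
        \<comment> \<open>There is no useful comparison from below, for instance when
          \<open>lim_pot x \<le> 0\<close>, but the expected density is itself at most
          \<open>e / 2\<close>.\<close>
        case False
        then have "s / pi \<le> e / 2" by (simp add: e'_def field_simps)
        then have "s / pi * (v - u) \<le> e / 2 * (v - u)" using uv by (intro mult_right_mono) auto
        moreover have "0 \<le> 1 / real n" "0 \<le> real (card (zeros n {u..<v})) / real n" by auto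
        ultimately show ?thesis by linarith
      qed
      show ?case unfolding s_def[symmetric] using up lo elim(1) by (simp add: abs_le_iff)
    qed
  qed
qed

text \<open>At a singular point \<open>cos (2 k x)\<close> is 1 or -1, so the squared sine depends
  on \<open>\<theta> - x\<close> alone. The radius makes the new argument smaller than 1, hence than
  \<open>pi / 2\<close>.\<close>

lemma sin_nonzero_near_singular:
  assumes "sin (2 * real k * x) = 0" "\<theta> \<noteq> x" "\<bar>\<theta> - x\<bar> < 1 / (2 * real k)"
  shows "2 * real k * (\<theta> - x) \<noteq> 0" "\<bar>2 * real k * (\<theta> - x)\<bar> < pi / 2"
    "(sin (2 * real k * \<theta>))\<^sup>2 = (sin (2 * real k * (\<theta> - x)))\<^sup>2" "sin (2 * real k * \<theta>) \<noteq> 0"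
proof -
  let ?y = "2 * real k * (\<theta> - x)"
  show y: "?y \<noteq> 0" using assms k by simp
  have "\<bar>?y\<bar> = 2 * real k * \<bar>\<theta> - x\<bar>" by (simp add: abs_mult)
  also have "\<dots> < 1" using assms(3) k by (simp add: pos_less_divide_eq mult.commute)
  finally have "\<bar>?y\<bar> < 1" .
  then show y2: "\<bar>?y\<bar> < pi / 2" using pi_gt3 by linarith
  have "sin (2 * real k * \<theta>) = sin (2 * real k * x + ?y)" by (simp add: algebra_simps)
  also have "\<dots> = cos (2 * real k * x) * sin ?y" unfolding sin_add using assms(1) by simp
  finally have "(sin (2 * real k * \<theta>))\<^sup>2 = (cos (2 * real k * x))\<^sup>2 * (sin ?y)\<^sup>2" by (simp add: power_mult_distrib)
  then show eq: "(sin (2 * real k * \<theta>))\<^sup>2 = (sin ?y)\<^sup>2" using assms(1) by (simp add: cos_squared_eq)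
  have "sin ?y \<noteq> 0"
  proof (cases "?y > 0")
    case True
    then show ?thesis using sin_gt_zero[of ?y] y2 by auto
  next
    case False
    then show ?thesis using sin_gt_zero[of "- ?y"] y2 y by (auto simp del: mult_minus_right)
  qed
  then show "sin (2 * real k * \<theta>) \<noteq> 0" using eq by auto
qed

text \<open>Both singular coefficients \<open>\<alpha> - \<alpha>\<^sup>2\<close> and \<open>\<gamma> / 2 - \<gamma>\<^sup>2 / 4\<close> are at most \<open>1 / 4\<close>, the
  non-oscillation threshold of an inverse square potential.\<close>

lemma pot_singular:
  assumes "sin (2 * real k * x) = 0"
  defines "K \<equiv> 1 + \<bar>1 + a + c / 2\<bar>"
  shows "\<forall>\<^sub>F n in sequentially. \<forall>\<theta>. \<theta> \<noteq> x \<and> \<bar>\<theta> - x\<bar> < 1 / (2 * real k)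
    \<longrightarrow> pot n \<theta> < (real k * real n * K)\<^sup>2 + 1 / (4 * (\<theta> - x)\<^sup>2)"
proof -
  \<comment> \<open>The added \<open>1 / n^2\<close> is the scaled remainder 1 of
    \<open>inverse_sin_squared_le\<close>; \<open>K\<close> exceeds the limiting frequency to make
    the inequality strict.\<close>
  have "(\<lambda>n. (real (M n) + \<alpha> n + \<gamma> n / 2)\<^sup>2 / (real n)\<^sup>2 + 1 / real n * (1 / real n)) \<longlonglongrightarrow> (1 + a + c / 2)\<^sup>2 + 0 * 0"
    by (intro tendsto_intros coefficient_limits lim_1_over_n)
  moreover have "(1 + a + c / 2)\<^sup>2 + 0 * 0 < K\<^sup>2"
    using power_strict_mono[of "\<bar>1 + a + c / 2\<bar>" K 2] by (simp add: K_def)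
  ultimately have "\<forall>\<^sub>F n in sequentially. (real (M n) + \<alpha> n + \<gamma> n / 2)\<^sup>2 / (real n)\<^sup>2 + 1 / real n * (1 / real n) < K\<^sup>2"
    by (rule order_tendstoD)
  then show ?thesis using eventually_gt_at_top[of 0]
  proof eventually_elim
    case (elim n)
    define A where "A = (real (M n) + \<alpha> n + \<gamma> n / 2)\<^sup>2"
    have "A / (real n)\<^sup>2 + 1 / (real n)\<^sup>2 < K\<^sup>2" using elim by (simp add: A_def power2_eq_square)
    then have A: "A + 1 < (real n * K)\<^sup>2" using elim(2) by (simp add: field_simps power_mult_distrib)
    show ?case
    proof (intro allI impI)
      fix \<theta> assume \<theta>: "\<theta> \<noteq> x \<and> \<bar>\<theta> - x\<bar> < 1 / (2 * real k)"
      let ?y = "2 * real k * (\<theta> - x)"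
      define s c' where "s = sin (real k * \<theta>)" and "c' = cos (real k * \<theta>)"
      note y = sin_nonzero_near_singular[OF assms(1) conjunct1[OF \<theta>] conjunct2[OF \<theta>]]
      have nz: "s \<noteq> 0" "c' \<noteq> 0" using sin_double_multiple_nonzero[OF y(4)] by (auto simp: s_def c'_def)
      have q1: "\<alpha> n - (\<alpha> n)\<^sup>2 \<le> 1 / 4" using zero_le_power2[of "\<alpha> n - 1 / 2"] by (simp add: power2_diff power_divide)
      have q2: "\<gamma> n / 2 - (\<gamma> n)\<^sup>2 / 4 \<le> 1 / 4" using zero_le_power2[of "\<gamma> n / 2 - 1 / 2"] by (simp add: power2_diff power_divide)
      have "pot n \<theta> \<le> (real k)\<^sup>2 * (A + (1 / 4) / s\<^sup>2 + (1 / 4) / c'\<^sup>2)"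
        unfolding pot_def potential_def A_def s_def c'_def
        using q1 q2 by (intro mult_left_mono add_mono order_refl divide_right_mono) auto
      \<comment> \<open>With both coefficients raised to 1/4 the singular terms merge: \<open>1 / (4
        s^2) + 1 / (4 c'^2) = 1 / (2 s c')^2 = 1 / sin^2 (2 k \<theta>)\<close>. Zeros of sine and
        of cosine are thus treated alike, and the factor \<open>k^2\<close> turns
        \<open>1 / ?y^2\<close> into exactly the critical
        \<open>1 / (4 (\<theta> - x)^2)\<close>.\<close>
      also have "(1 / 4) / s\<^sup>2 = 1 / 4 * c'\<^sup>2 / (s\<^sup>2 * c'\<^sup>2)" using nz by simp
      also have "A + 1 / 4 * c'\<^sup>2 / (s\<^sup>2 * c'\<^sup>2) + (1 / 4) / c'\<^sup>2 = A + 1 / (2 * s * c')\<^sup>2"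
      proof -
        have "(1 / 4) / c'\<^sup>2 = 1 / 4 * s\<^sup>2 / (s\<^sup>2 * c'\<^sup>2)" using nz by simp
        then have "1 / 4 * c'\<^sup>2 / (s\<^sup>2 * c'\<^sup>2) + (1 / 4) / c'\<^sup>2 = 1 / 4 * (c'\<^sup>2 + s\<^sup>2) / (s\<^sup>2 * c'\<^sup>2)"
          by (simp only: add_divide_distrib distrib_left)
        also have "c'\<^sup>2 + s\<^sup>2 = 1" by (simp add: s_def c'_def)
        finally show ?thesis by (simp add: power_mult_distrib)
      qed
      also have "(2 * s * c')\<^sup>2 = (sin (2 * real k * \<theta>))\<^sup>2"
        using sin_double[of "real k * \<theta>"] by (simp add: s_def c'_def mult.assoc)
      also have "\<dots> = (sin ?y)\<^sup>2" by (rule y(3))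
      also have "(real k)\<^sup>2 * (A + 1 / (sin ?y)\<^sup>2) \<le> (real k)\<^sup>2 * (A + (1 / ?y\<^sup>2 + 1))"
        using inverse_sin_squared_le[OF y(1,2)] by (intro mult_left_mono add_left_mono) auto
      also have "\<dots> = (real k)\<^sup>2 * (A + 1) + 1 / (4 * (\<theta> - x)\<^sup>2)"
        using k by (simp add: distrib_left power_mult_distrib)
      also have "(real k)\<^sup>2 * (A + 1) < (real k)\<^sup>2 * (real n * K)\<^sup>2"
        using A k by (intro mult_strict_left_mono) auto
      finally show "pot n \<theta> < (real k * real n * K)\<^sup>2 + 1 / (4 * (\<theta> - x)\<^sup>2)"
        by (simp add: power_mult_distrib mult_ac)
    qed
  qed
qed

text \<open>A bound of the right order suffices here. The interval is cut at \<open>x\<close>, and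
  on each open half the critical comparison spaces the zeros by at least a constant over
  \<open>n\<close>.\<close>

lemma zeros_singular:
  assumes x: "sin (2 * real k * x) = 0"
  shows "\<exists>C. \<exists>d>0. \<forall>u v. 0 \<le> u \<and> u \<le> x \<and> x \<le> v \<and> v \<le> pi \<and> u < v \<and> v - u < d \<longrightarrow>
    (\<forall>\<^sub>F n in sequentially. \<bar>real (card (zeros n {u..<v})) / real n\<bar> \<le> C * (v - u))"
proof -
  define K where "K = 1 + \<bar>1 + a + c / 2\<bar>"
  define C where "C = 2 * (real k * K) / pi"
  have "K > 0" by (simp add: K_def)
  have "1 / (2 * real k) > 0" using k by simp
  moreover have "\<forall>\<^sub>F n in sequentially. \<bar>real (card (zeros n {u..<v})) / real n\<bar> \<le> (C + 1) * (v - u)"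
    if uv: "0 \<le> u \<and> u \<le> x \<and> x \<le> v \<and> v \<le> pi \<and> u < v \<and> v - u < 1 / (2 * real k)" for u v
  proof -
    \<comment> \<open>The 4 collects the points \<open>u\<close> and \<open>x\<close> and one
      surplus zero from each half.\<close>
    have "\<forall>\<^sub>F n in sequentially. 4 / real n \<le> v - u"
      using uv by (intro eventually_const_divide_le) auto
    then show ?thesis using pot_singular[OF x] eventually_gt_at_top[of 0]
    proof eventually_elim
      case (elim n)
      define m where "m = real k * real n * K"
      have n: "real n > 0" using elim by simp
      then have m: "m > 0" using k \<open>K > 0\<close> by (simp add: m_def)
      have Gm: "pot n \<theta> < m\<^sup>2 + 1 / (4 * (\<theta> - x)\<^sup>2)" if "\<theta> \<noteq> x" "\<bar>\<theta> - x\<bar> < 1 / (2 * real k)" for \<theta>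
        using elim(2) that unfolding m_def K_def by blast
      have right: "real (card (zeros n {x<..<v})) \<le> (v - x) * (2 * m / pi) + 1"
      proof (cases "x < v")
        case True
        show ?thesis
        proof (rule card_zeros_singular_right[OF _ _ True m])
          fix \<theta> assume \<theta>: "x < \<theta>" "\<theta> < v"
          then have t: "\<theta> \<noteq> x" "\<bar>\<theta> - x\<bar> < 1 / (2 * real k)" using uv by auto
          show "sin (2 * real k * \<theta>) \<noteq> 0" by (rule sin_nonzero_near_singular(4)[OF x t])
          show "pot n \<theta> < m\<^sup>2 + 1 / (4 * (\<theta> - x)\<^sup>2)" by (rule Gm[OF t])
        qed (use uv in auto)
      qed (use uv in \<open>simp add: zeros_def\<close>)
      have left: "real (card (zeros n {u<..<x})) \<le> (x - u) * (2 * m / pi) + 1"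
      proof (cases "u < x")
        case True
        show ?thesis
        proof (rule card_zeros_singular_left[OF _ _ True m])
          fix \<theta> assume \<theta>: "u < \<theta>" "\<theta> < x"
          then have t: "\<theta> \<noteq> x" "\<bar>\<theta> - x\<bar> < 1 / (2 * real k)" using uv by auto
          show "sin (2 * real k * \<theta>) \<noteq> 0" by (rule sin_nonzero_near_singular(4)[OF x t])
          show "pot n \<theta> < m\<^sup>2 + 1 / (4 * (x - \<theta>)\<^sup>2)" using Gm[OF t] by (simp add: power2_commute)
        qed (use uv in auto)
      qed (use uv in \<open>simp add: zeros_def\<close>)
      have "zeros n {u..<v} \<subseteq> insert u (insert x (zeros n {u<..<x} \<union> zeros n {x<..<v}))"
        by (auto simp: zeros_def)
      moreover have fin: "finite (zeros n {u<..<x})" "finite (zeros n {x<..<v})"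
        using uv by (auto intro!: finite_zeros)
      ultimately have "card (zeros n {u..<v}) \<le> card (insert u (insert x (zeros n {u<..<x} \<union> zeros n {x<..<v})))"
        by (intro card_mono) auto
      also have "\<dots> \<le> 1 + (1 + (card (zeros n {u<..<x}) + card (zeros n {x<..<v})))"
      proof -
        have ins: "card (insert z B) \<le> 1 + card B" if "finite B" for z and B :: "real set"
          using that by (simp add: card_insert_if)
        have "card (insert u (insert x (zeros n {u<..<x} \<union> zeros n {x<..<v})))
            \<le> 1 + card (insert x (zeros n {u<..<x} \<union> zeros n {x<..<v}))"
          using fin by (intro ins) simp
        moreover have "card (insert x (zeros n {u<..<x} \<union> zeros n {x<..<v}))
            \<le> 1 + card (zeros n {u<..<x} \<union> zeros n {x<..<v})"
          using fin by (intro ins) simp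
        ultimately show ?thesis
          using card_Un_le[of "zeros n {u<..<x}" "zeros n {x<..<v}"] by linarith
      qed
      finally have "real (card (zeros n {u..<v})) \<le> 2 + (real (card (zeros n {u<..<x})) + real (card (zeros n {x<..<v})))"
        by simp
      also have "\<dots> \<le> (v - u) * (2 * m / pi) + 4"
      proof -
        have "(v - u) * r = (v - x) * r + (x - u) * r" for r :: real by (simp add: left_diff_distrib)
        from this[of "2 * m / pi"] show ?thesis using left right by linarith
      qed
      finally have "real (card (zeros n {u..<v})) / real n \<le> ((v - u) * (2 * m / pi) + 4) / real n"
        by (rule divide_right_mono) simp
      also have "\<dots> = C * (v - u) + 4 / real n"
        using n by (simp add: m_def C_def field_simps)
      finally show ?case using elim(1) by (simp add: distrib_right)
    qed
  qed
  ultimately show ?thesis by blast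
qed

end

section \<open>The limiting density\<close>

context sieved_zeros
begin

text \<open>The value 0 at singular points agrees with the stated integrand, whose denominator
  vanishes there and whose quotient is then 0 by convention.\<close>

definition density :: "real \<Rightarrow> real" where
  "density \<theta> = (if sin (2 * real k * \<theta>) = 0 then 0 else sqrt (max (lim_pot \<theta>) 0) / pi)"

lemma measurable_density [measurable]: "density \<in> borel_measurable borel"
proof -
  have "lim_pot = (\<lambda>\<theta>. (real k)\<^sup>2 * ((1 + a + c / 2)\<^sup>2 + - a\<^sup>2 / (sin (real k * \<theta>))\<^sup>2 + - c\<^sup>2 / 4 / (cos (real k * \<theta>))\<^sup>2))"
    by (auto simp: lim_pot_def potential_def)
  then have [measurable]: "lim_pot \<in> borel_measurable borel" by simp
  have eq: "density = (\<lambda>\<theta>. if sin (2 * real k * \<theta>) = 0 then 0 else sqrt (max (lim_pot \<theta>) 0) / pi)"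
    by (auto simp: density_def)
  show ?thesis unfolding eq by measurable
qed

text \<open>In the limit the singular terms have the coefficients \<open>- a^2\<close> and
  \<open>- c^2 / 4\<close>, so they can only lower the potential.\<close>

lemma abs_density_le: "\<bar>density \<theta>\<bar> \<le> real k * \<bar>1 + a + c / 2\<bar> / pi"
proof (cases "sin (2 * real k * \<theta>) = 0")
  case False
  have "lim_pot \<theta> \<le> (real k)\<^sup>2 * (1 + a + c / 2)\<^sup>2"
  proof -
    have "- a\<^sup>2 / (sin (real k * \<theta>))\<^sup>2 \<le> 0" "- c\<^sup>2 / 4 / (cos (real k * \<theta>))\<^sup>2 \<le> 0"
      by (intro divide_nonpos_nonneg; simp)+
    then show ?thesis unfolding lim_pot_def potential_def by (intro mult_left_mono) (linarith, simp)
  qed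
  also have "\<dots> = (real k * \<bar>1 + a + c / 2\<bar>)\<^sup>2" by (simp add: power_mult_distrib)
  finally have "sqrt (max (lim_pot \<theta>) 0) \<le> real k * \<bar>1 + a + c / 2\<bar>"
    by (intro real_le_lsqrt) auto
  then show ?thesis using False by (simp add: density_def divide_right_mono)
qed (simp add: density_def)

lemma isCont_density:
  assumes "sin (2 * real k * x) \<noteq> 0"
  shows "isCont density x"
proof -
  note nz = sin_double_multiple_nonzero[OF assms]
  have "open {\<theta>. sin (2 * real k * \<theta>) \<noteq> 0}" by (intro open_Collect_neq continuous_intros)
  then have "eventually (\<lambda>\<theta>. \<theta> \<in> {\<theta>. sin (2 * real k * \<theta>) \<noteq> 0}) (nhds x)"
    using assms by (intro eventually_nhds_in_open) auto
  then have ev: "eventually (\<lambda>\<theta>. density \<theta> = sqrt (max (lim_pot \<theta>) 0) / pi) (nhds x)"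
    by eventually_elim (simp add: density_def)
  have "isCont (\<lambda>\<theta>. sqrt (max (lim_pot \<theta>) 0) / pi) x"
    unfolding lim_pot_def potential_def using nz by (intro continuous_intros) auto
  then show ?thesis by (simp only: isCont_cong[OF ev])
qed

lemma density_absolutely_integrable: "density absolutely_integrable_on {u..v}"
proof (rule measurable_bounded_by_integrable_imp_absolutely_integrable)
  show "density \<in> borel_measurable (lebesgue_on {u..v})"
    by (intro measurable_restrict_space1 measurable_completion) simp
  show "(\<lambda>_. real k * \<bar>1 + a + c / 2\<bar> / pi) integrable_on {u..v}" by (rule integrable_const_ivl)
qed (use abs_density_le in auto)

lemma tendsto_zeros:
  assumes "0 \<le> p" "p \<le> pi"
  shows "(\<lambda>n. real (card (zeros n {p..<pi})) / real n) \<longlonglongrightarrow> integral {p..pi} density"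
proof (rule tendsto_integral_from_local_density[where N = "\<lambda>n u v. real (card (zeros n {u..<v})) / real n" and
      S = "{\<theta>. 0 \<le> \<theta> \<and> \<theta> \<le> pi \<and> sin (real (2 * k) * \<theta>) = 0}" and B = "real k * \<bar>1 + a + c / 2\<bar> / pi"])
  show "finite {\<theta>. 0 \<le> \<theta> \<and> \<theta> \<le> pi \<and> sin (real (2 * k) * \<theta>) = 0}" using k by (intro finite_sin_zeros) simp
  show "density integrable_on {p..pi}" using density_absolutely_integrable by (rule set_lebesgue_integral_eq_integral(1))
  show "real (card (zeros n {u..<w})) / real n = real (card (zeros n {u..<v})) / real n + real (card (zeros n {v..<w})) / real n"
    if "p \<le> u" "u \<le> v" "v \<le> w" "w \<le> pi" for n u v w
  proof -
    have "zeros n {u..<w} = zeros n {u..<v} \<union> zeros n {v..<w}" using that by (auto simp: zeros_def)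
    moreover have "card (zeros n {u..<v} \<union> zeros n {v..<w}) = card (zeros n {u..<v}) + card (zeros n {v..<w})"
    proof (rule card_Un_disjoint)
      show "finite (zeros n {u..<v})" "finite (zeros n {v..<w})"
        using that assms by (auto intro!: finite_zeros)
    qed (auto simp: zeros_def)
    ultimately show ?thesis by (simp add: add_divide_distrib)
  qed
  fix x e :: real assume x: "x \<in> {p..pi} - {\<theta>. 0 \<le> \<theta> \<and> \<theta> \<le> pi \<and> sin (real (2 * k) * \<theta>) = 0}"
  then have x': "x \<in> {0..pi}" "sin (2 * real k * x) \<noteq> 0" using assms by auto
  show "isCont density x" by (rule isCont_density[OF x'(2)])
  assume "e > 0"
  from zeros_regular[OF x' this] obtain d where d: "d > 0"
    "\<forall>u v. 0 \<le> u \<and> u \<le> x \<and> x \<le> v \<and> v \<le> pi \<and> u < v \<and> v - u < d \<longrightarrow>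
      (\<forall>\<^sub>F n in sequentially. \<bar>real (card (zeros n {u..<v})) / real n - sqrt (max (lim_pot x) 0) / pi * (v - u)\<bar> \<le> e * (v - u))"
    by (elim exE conjE)
  have gx: "density x = sqrt (max (lim_pot x) 0) / pi" using x'(2) by (simp add: density_def)
  show "\<exists>d>0. \<forall>u v. p \<le> u \<and> u \<le> x \<and> x \<le> v \<and> v \<le> pi \<and> u < v \<and> v - u < d \<longrightarrow>
      (\<forall>\<^sub>F n in sequentially. \<bar>real (card (zeros n {u..<v})) / real n - density x * (v - u)\<bar> \<le> e * (v - u))"
    unfolding gx
  proof (intro exI[of _ d] conjI allI impI d(1))
    fix u v assume "p \<le> u \<and> u \<le> x \<and> x \<le> v \<and> v \<le> pi \<and> u < v \<and> v - u < d"
    then show "\<forall>\<^sub>F n in sequentially. \<bar>real (card (zeros n {u..<v})) / real n - sqrt (max (lim_pot x) 0) / pi * (v - u)\<bar> \<le> e * (v - u)"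
      using assms(1) by (intro d(2)[rule_format]) auto
  qed
next
  fix x assume "x \<in> {p..pi} \<inter> {\<theta>. 0 \<le> \<theta> \<and> \<theta> \<le> pi \<and> sin (real (2 * k) * \<theta>) = 0}"
  then have "sin (2 * real k * x) = 0" by auto
  from zeros_singular[OF this] obtain C d where d: "d > 0"
    "\<forall>u v. 0 \<le> u \<and> u \<le> x \<and> x \<le> v \<and> v \<le> pi \<and> u < v \<and> v - u < d \<longrightarrow>
      (\<forall>\<^sub>F n in sequentially. \<bar>real (card (zeros n {u..<v})) / real n\<bar> \<le> C * (v - u))"
    by (elim exE conjE)
  show "\<exists>C. \<exists>d>0. \<forall>u v. p \<le> u \<and> u \<le> x \<and> x \<le> v \<and> v \<le> pi \<and> u < v \<and> v - u < d \<longrightarrow>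
      (\<forall>\<^sub>F n in sequentially. \<bar>real (card (zeros n {u..<v})) / real n\<bar> \<le> C * (v - u))"
  proof (rule exI[of _ C], rule exI[of _ d], intro conjI allI impI d(1))
    fix u v assume "p \<le> u \<and> u \<le> x \<and> x \<le> v \<and> v \<le> pi \<and> u < v \<and> v - u < d"
    then show "\<forall>\<^sub>F n in sequentially. \<bar>real (card (zeros n {u..<v})) / real n\<bar> \<le> C * (v - u)"
      using assms(1) by (intro d(2)[rule_format]) auto
  qed
qed (use assms abs_density_le in auto)

text \<open>The cosine is decreasing, so \<open>x \<le> y\<close> means
  \<open>\<theta> \<ge> arccos y\<close>. The half-open interval loses nothing at \<open>pi\<close>,
  since no zero is at most -1.\<close>

lemma zero_count_eq_card_zeros:
  assumes "y \<in> {-1..1}"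
  shows "zero_count k (\<alpha> n) (\<gamma> n) (M n * k) y = card (zeros n {arccos y..<pi})"
proof -
  have "bij_betw cos (zeros n {arccos y..<pi}) {x. x \<le> y \<and> poly (sieved_C k (\<alpha> n) (\<gamma> n) (M n * k)) x = 0}"
  proof (rule bij_betwI[where g = arccos])
    show "cos \<in> zeros n {arccos y..<pi} \<rightarrow> {x. x \<le> y \<and> poly (sieved_C k (\<alpha> n) (\<gamma> n) (M n * k)) x = 0}"
    proof
      fix \<theta> assume t: "\<theta> \<in> zeros n {arccos y..<pi}"
      then have "cos \<theta> \<le> cos (arccos y)" using assms arccos_lbound[of y]
        by (intro cos_monotone_0_pi_le) (auto simp: zeros_def)
      then show "cos \<theta> \<in> {x. x \<le> y \<and> poly (sieved_C k (\<alpha> n) (\<gamma> n) (M n * k)) x = 0}"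
        using t assms by (simp add: zeros_def cos_arccos)
    qed
    have gt: "-1 < x" if "poly (sieved_C k (\<alpha> n) (\<gamma> n) (M n * k)) x = 0" for x
      using sieved_C_neg_nonzero[OF k \<alpha> \<gamma>] that by (metis not_le)
    show "arccos \<in> {x. x \<le> y \<and> poly (sieved_C k (\<alpha> n) (\<gamma> n) (M n * k)) x = 0} \<rightarrow> zeros n {arccos y..<pi}"
    proof
      fix x assume x: "x \<in> {x. x \<le> y \<and> poly (sieved_C k (\<alpha> n) (\<gamma> n) (M n * k)) x = 0}"
      then have b: "-1 < x" "x \<le> y" "x \<le> 1" using gt assms by auto
      then have "arccos y \<le> arccos x" using assms by (intro arccos_le_arccos) auto
      moreover have "arccos x < pi" using arccos_less_arccos[of "-1" x] b by simp
      ultimately show "arccos x \<in> zeros n {arccos y..<pi}" using x b by (simp add: zeros_def cos_arccos)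
    qed
    show "arccos (cos \<theta>) = \<theta>" if "\<theta> \<in> zeros n {arccos y..<pi}" for \<theta>
      using that assms arccos_lbound[of y] by (intro arccos_cos) (auto simp: zeros_def)
    show "cos (arccos x) = x" if "x \<in> {x. x \<le> y \<and> poly (sieved_C k (\<alpha> n) (\<gamma> n) (M n * k)) x = 0}" for x
      using that gt[of x] assms by (intro cos_arccos) auto
  qed
  then show ?thesis unfolding zero_count_def by (metis bij_betw_same_card)
qed

end

text \<open>For \<open>u = cos^2 (k \<theta>)\<close> the right side is \<open>lim_pot / k^2\<close>
  multiplied by \<open>u * (1 - u)\<close>, and the left side is its completed square. This is where
  \<open>mu_ac\<close> and \<open>kappa_ac\<close> come from.\<close>

lemma radicand_identity:
  fixes a c u :: real
  assumes "2 * a + c + 2 \<noteq> 0"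
  shows "(2 * a + c + 2)\<^sup>2 / 4 * (4 * mu_ac a c - (u - kappa_ac a c)\<^sup>2)
    = (1 + a + c / 2)\<^sup>2 * (u * (1 - u)) - a\<^sup>2 * u - c\<^sup>2 / 4 * (1 - u)"
proof -
  define D where "D = 2 * a + c + 2"
  define K where "K = (2 * a + 1) * (c + 2) + c * (c + 1)"
  define N where "N = (2 * a + 1) * (c + 1) * (2 * a + c + 1)"
  have D: "D \<noteq> 0" using assms by (simp add: D_def)
  have mu: "D ^ 4 * mu_ac a c = N" using D by (simp add: mu_ac_def D_def N_def)
  have kap: "D\<^sup>2 * kappa_ac a c = K" using D by (simp add: kappa_ac_def D_def K_def)
  have "D ^ 4 * (4 * mu_ac a c - (u - kappa_ac a c)\<^sup>2) = 4 * (D ^ 4 * mu_ac a c) - (D\<^sup>2 * u - D\<^sup>2 * kappa_ac a c)\<^sup>2"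
    by (simp add: power2_eq_square power4_eq_xxxx algebra_simps)
  also have "\<dots> = 4 * N - (D\<^sup>2 * u - K)\<^sup>2" unfolding mu kap ..
  also have "\<dots> = D\<^sup>2 * (D\<^sup>2 * (u * (1 - u)) - 4 * a\<^sup>2 * u - c\<^sup>2 * (1 - u))"
    unfolding D_def N_def K_def by algebra
  finally have "D\<^sup>2 * (D\<^sup>2 * (4 * mu_ac a c - (u - kappa_ac a c)\<^sup>2)) = D\<^sup>2 * (D\<^sup>2 * (u * (1 - u)) - 4 * a\<^sup>2 * u - c\<^sup>2 * (1 - u))"
    by (simp only: power2_eq_square power4_eq_xxxx mult.assoc)
  then have "D\<^sup>2 * (4 * mu_ac a c - (u - kappa_ac a c)\<^sup>2) = D\<^sup>2 * (u * (1 - u)) - 4 * a\<^sup>2 * u - c\<^sup>2 * (1 - u)"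
    by (rule mult_left_cancel[THEN iffD1, rotated]) (use D in simp)
  then have "D\<^sup>2 / 4 * (4 * mu_ac a c - (u - kappa_ac a c)\<^sup>2) = (D\<^sup>2 * (u * (1 - u)) - 4 * a\<^sup>2 * u - c\<^sup>2 * (1 - u)) / 4"
    by simp
  also have "\<dots> = D\<^sup>2 / 4 * (u * (1 - u)) - a\<^sup>2 * u - c\<^sup>2 / 4 * (1 - u)"
    by (simp add: diff_divide_distrib)
  finally have eq: "D\<^sup>2 / 4 * (4 * mu_ac a c - (u - kappa_ac a c)\<^sup>2)
    = D\<^sup>2 / 4 * (u * (1 - u)) - a\<^sup>2 * u - c\<^sup>2 / 4 * (1 - u)" .
  have "(1 + a + c / 2)\<^sup>2 = D\<^sup>2 / 4" by (simp add: D_def power2_eq_square field_simps)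
  with eq show ?thesis by (simp only: D_def)
qed

text \<open>Nonnegativity of the radicand is a closed condition and passes from the set to its
  closure; outside the set the radicand is nonpositive. The \<open>max\<close> is essential because
  \<open>sqrt\<close> of a negative number is negative.\<close>

lemma sqrt_indicator_closure_E_set:
  assumes "x \<in> {-1..1}"
  shows "sqrt (4 * \<mu> - ((poly (cheb_T k) x)\<^sup>2 - \<kappa>)\<^sup>2) * indicator (closure (E_set k \<kappa> \<mu>)) x
    = sqrt (max (4 * \<mu> - ((poly (cheb_T k) x)\<^sup>2 - \<kappa>)\<^sup>2) 0)"
proof (cases "x \<in> closure (E_set k \<kappa> \<mu>)")
  case True
  have "closed {x. ((poly (cheb_T k) x)\<^sup>2 - \<kappa>)\<^sup>2 \<le> 4 * \<mu>}"
    by (intro closed_Collect_le continuous_intros)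
  then have "closure (E_set k \<kappa> \<mu>) \<subseteq> {x. ((poly (cheb_T k) x)\<^sup>2 - \<kappa>)\<^sup>2 \<le> 4 * \<mu>}"
    by (rule closure_minimal[rotated]) (auto simp: E_set_def)
  then show ?thesis using True by auto
next
  case False
  then have "x \<notin> E_set k \<kappa> \<mu>" using closure_subset by blast
  then show ?thesis using False assms by (simp add: E_set_def max_def)
qed

text \<open>The Jacobian \<open>sin \<theta>\<close> and the relation
  \<open>sin \<theta> * U = sin k\<theta>\<close> reduce the denominator to
  \<open>|sin k\<theta>| |cos k\<theta>|\<close>. Where it vanishes, both sides are 0, so the
  equation holds at every angle.\<close>

lemma (in sieved_zeros) integrand_eq:
  assumes ac: "a \<ge> 0" "c \<ge> 0" and \<theta>: "\<theta> \<in> {0..pi}"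
  defines "x \<equiv> cos \<theta>"
  shows "\<bar>- sin \<theta>\<bar> * (sqrt (4 * mu_ac a c - ((poly (cheb_T k) x)\<^sup>2 - kappa_ac a c)\<^sup>2)
          / (\<bar>poly (cheb_U (k - 1)) x\<bar> * \<bar>poly (cheb_T k) x\<bar> * (1 - x\<^sup>2))
        * indicator (closure (E_set k (kappa_ac a c) (mu_ac a c))) x)
    = 2 * pi / (real k * (2 * a + c + 2)) * density \<theta>"
proof -
  define s C where "s = \<bar>sin (real k * \<theta>)\<bar>" and "C = \<bar>cos (real k * \<theta>)\<bar>"
  define D where "D = 2 * a + c + 2"
  define R where "R = 4 * mu_ac a c - (C\<^sup>2 - kappa_ac a c)\<^sup>2"
  have D: "D > 0" using ac by (simp add: D_def)
  have T: "\<bar>poly (cheb_T k) x\<bar> = C" by (simp add: x_def C_def poly_cheb_T_cos)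
  then have T2: "(poly (cheb_T k) x)\<^sup>2 = C\<^sup>2" by (metis power2_abs)
  have U: "sin \<theta> * \<bar>poly (cheb_U (k - 1)) x\<bar> = s"
  proof -
    have "sin \<theta> * poly (cheb_U (k - 1)) x = sin (real k * \<theta>)"
      using poly_cheb_U_cos[of \<theta> "k - 1"] k by (simp add: x_def)
    moreover have "sin \<theta> \<ge> 0" using \<theta> by (intro sin_ge_zero) auto
    ultimately show ?thesis by (metis abs_mult abs_of_nonneg s_def)
  qed
  have "x \<in> {-1..1}" by (simp add: x_def)
  note ind = sqrt_indicator_closure_E_set[OF this, of "mu_ac a c" k "kappa_ac a c"]
  have sin2: "1 - x\<^sup>2 = (sin \<theta>)\<^sup>2" by (simp add: x_def sin_squared_eq)
  have "\<bar>- sin \<theta>\<bar> * (sqrt (4 * mu_ac a c - ((poly (cheb_T k) x)\<^sup>2 - kappa_ac a c)\<^sup>2)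
          / (\<bar>poly (cheb_U (k - 1)) x\<bar> * \<bar>poly (cheb_T k) x\<bar> * (1 - x\<^sup>2))
        * indicator (closure (E_set k (kappa_ac a c) (mu_ac a c))) x)
     = \<bar>sin \<theta>\<bar> * (sqrt (max R 0) / (\<bar>poly (cheb_U (k - 1)) x\<bar> * C * (1 - x\<^sup>2)))"
    unfolding T R_def T2[symmetric] ind[symmetric] by simp
  also have "\<dots> = sqrt (max R 0) / (s * C)"
  proof (cases "sin \<theta> = 0")
    case True
    then show ?thesis using U by simp
  next
    case False
    then have pos: "sin \<theta> > 0" using \<theta> sin_ge_zero[of \<theta>] by (simp add: less_le)
    then show ?thesis unfolding sin2 U[symmetric] by (simp add: power2_eq_square)
  qed
  also have "\<dots> = 2 * pi / (real k * D) * density \<theta>"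
  proof (cases "sin (2 * real k * \<theta>) = 0")
    case True
    then have "s * C = 0" using sin_double[of "real k * \<theta>"] by (auto simp: s_def C_def mult.assoc)
    then show ?thesis using True by (simp add: density_def)
  next
    case False
    have s: "s > 0" "C > 0" using sin_double_multiple_nonzero[OF False] by (auto simp: s_def C_def)
    have sC: "1 - C\<^sup>2 = s\<^sup>2" by (simp add: s_def C_def sin_squared_eq)
    have "lim_pot \<theta> = (real k)\<^sup>2 * ((1 + a + c / 2)\<^sup>2 - a\<^sup>2 / s\<^sup>2 - c\<^sup>2 / 4 / C\<^sup>2)"
      by (simp add: lim_pot_def potential_def s_def C_def)
    also have "(1 + a + c / 2)\<^sup>2 - a\<^sup>2 / s\<^sup>2 - c\<^sup>2 / 4 / C\<^sup>2
      = ((1 + a + c / 2)\<^sup>2 * (C\<^sup>2 * s\<^sup>2) - a\<^sup>2 * C\<^sup>2 - c\<^sup>2 / 4 * s\<^sup>2) / (s * C)\<^sup>2"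
      using s by (simp add: diff_divide_distrib power_mult_distrib)
    also have "(1 + a + c / 2)\<^sup>2 * (C\<^sup>2 * s\<^sup>2) - a\<^sup>2 * C\<^sup>2 - c\<^sup>2 / 4 * s\<^sup>2 = D\<^sup>2 / 4 * R"
      using radicand_identity[of a c "C\<^sup>2"] D unfolding R_def D_def sC by simp
    finally have lim_pot: "lim_pot \<theta> = (real k * D / (2 * (s * C)))\<^sup>2 * R"
      by (simp add: power_divide power_mult_distrib)
    have "max (lim_pot \<theta>) 0 = (real k * D / (2 * (s * C)))\<^sup>2 * max R 0"
      unfolding lim_pot by (simp add: max_mult_distrib_left)
    then have "sqrt (max (lim_pot \<theta>) 0) = real k * D / (2 * (s * C)) * sqrt (max R 0)"
      using s D by (simp add: real_sqrt_mult)
    then show ?thesis using False s D k by (simp add: density_def)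
  qed
  finally show ?thesis by (simp only: D_def)
qed

text \<open>The change of variables also transfers absolute integrability, so the possibly unbounded
  integrand in \<open>x\<close> inherits it from the bounded density in
  \<open>\<theta>\<close>.\<close>

lemma (in sieved_zeros) integral_density:
  assumes ac: "a \<ge> 0" "c \<ge> 0" and y: "y \<in> {-1..1}"
  shows "(2 * a + c + 2) / (2 * pi) *
      (LBINT x:{-1..y}.
        sqrt (4 * mu_ac a c - ((poly (cheb_T k) x)\<^sup>2 - kappa_ac a c)\<^sup>2)
          / (\<bar>poly (cheb_U (k - 1)) x\<bar> * \<bar>poly (cheb_T k) x\<bar> * (1 - x\<^sup>2))
        * indicator (closure (E_set k (kappa_ac a c) (mu_ac a c))) x)
    = integral {arccos y..pi} density / real k"
proof -
  define \<psi> where "\<psi> = (\<lambda>x. sqrt (4 * mu_ac a c - ((poly (cheb_T k) x)\<^sup>2 - kappa_ac a c)\<^sup>2)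
          / (\<bar>poly (cheb_U (k - 1)) x\<bar> * \<bar>poly (cheb_T k) x\<bar> * (1 - x\<^sup>2))
        * indicator (closure (E_set k (kappa_ac a c) (mu_ac a c))) x)"
  let ?S = "{arccos y..pi}" and ?r = "2 * pi / (real k * (2 * a + c + 2))"
  have S0: "?S \<subseteq> {0..pi}" using y arccos_lbound[of y] by auto
  have img: "cos ` ?S = {-1..y}"
  proof
    show "cos ` ?S \<subseteq> {-1..y}"
    proof
      fix x assume "x \<in> cos ` ?S"
      then obtain \<theta> where \<theta>: "x = cos \<theta>" "arccos y \<le> \<theta>" "\<theta> \<le> pi" by auto
      have "cos \<theta> \<le> cos (arccos y)" using \<theta> y arccos_lbound[of y] by (intro cos_monotone_0_pi_le) auto
      then show "x \<in> {-1..y}" using \<theta> y by (simp add: cos_arccos)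
    qed
    show "{-1..y} \<subseteq> cos ` ?S"
    proof
      fix x assume x: "x \<in> {-1..y}"
      then have "arccos x \<in> ?S" "x = cos (arccos x)"
        using y arccos_le_arccos[of x y] arccos_ubound[of x] by (auto simp: cos_arccos)
      then show "x \<in> cos ` ?S" by blast
    qed
  qed
  have eq: "\<bar>- sin \<theta>\<bar> * \<psi> (cos \<theta>) = ?r * density \<theta>" if "\<theta> \<in> ?S" for \<theta>
    unfolding \<psi>_def using integrand_eq[OF ac, of \<theta>] that S0 by blast
  have "(\<lambda>\<theta>. ?r * density \<theta>) absolutely_integrable_on ?S"
    by (intro set_integrable_mult_right density_absolutely_integrable)
  then have "(\<lambda>\<theta>. \<bar>- sin \<theta>\<bar> * \<psi> (cos \<theta>)) absolutely_integrable_on ?S"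
    by (rule set_integrable_cong[OF refl refl eq, THEN iffD2, rotated])
  moreover have "integral ?S (\<lambda>\<theta>. \<bar>- sin \<theta>\<bar> * \<psi> (cos \<theta>)) = integral ?S (\<lambda>\<theta>. ?r * density \<theta>)"
    by (intro integral_cong eq)
  then have "integral ?S (\<lambda>\<theta>. \<bar>- sin \<theta>\<bar> * \<psi> (cos \<theta>)) = ?r * integral ?S density"
    by (simp only: integral_mult_right)
  moreover have "inj_on cos ?S"
  proof (rule inj_on_subset[OF _ S0])
    show "inj_on cos {0..pi}" by (rule inj_onI) (simp add: cos_inj_pi)
  qed
  moreover have "(cos has_field_derivative - sin x) (at x within ?S)" for x
    by (auto intro!: derivative_eq_intros)
  ultimately have "\<psi> absolutely_integrable_on cos ` ?S \<and> integral (cos ` ?S) \<psi> = ?r * integral ?S density"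
    using has_absolute_integral_change_of_variables_1'[of ?S cos "\<lambda>\<theta>. - sin \<theta>" \<psi> "?r * integral ?S density"] by simp
  then have \<psi>: "set_integrable lebesgue {-1..y} \<psi>" "integral {-1..y} \<psi> = ?r * integral ?S density"
    unfolding img by auto
  have [measurable]: "(\<lambda>x. poly q x) \<in> borel_measurable borel" for q :: "real poly"
    by (intro borel_measurable_continuous_onI continuous_intros)
  have [measurable]: "closure (E_set k (kappa_ac a c) (mu_ac a c)) \<in> sets borel" by simp
  have [measurable]: "\<psi> \<in> borel_measurable borel" unfolding \<psi>_def by measurable
  \<comment> \<open>The change of variables works with the completed measure; Borel measurability of
    \<open>\<psi>\<close> leads back to \<open>lborel\<close>.\<close>
  have "set_integrable lborel {-1..y} \<psi>"
    using \<psi>(1) unfolding set_integrable_def by (subst (asm) integrable_completion) auto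
  then have "(LBINT x:{-1..y}. \<psi> x) = ?r * integral ?S density"
    using set_borel_integral_eq_integral(2) \<psi>(2) by metis
  moreover have "D / (2 * pi) * (2 * pi / (real k * D) * I) = I / real k" if "D > 0" for D I :: real
    using that k by simp
  moreover have "2 * a + c + 2 > 0" using ac by simp
  ultimately show ?thesis unfolding \<psi>_def by metis
qed

section \<open>From even multiples of k to all degrees\<close>

theorem theorem4p3:
  fixes k :: nat and \<alpha> \<gamma> :: "nat \<Rightarrow> real" and a c y :: real
  assumes "k \<ge> 2"
    and "\<And>l. \<alpha> l > -1/2"
    and "\<And>l. \<gamma> l > -1"
    and "(\<lambda>l. \<alpha> l / real l) \<longlonglongrightarrow> a" and "a \<ge> 0"
    and "(\<lambda>l. \<gamma> l / real l) \<longlonglongrightarrow> c" and "c \<ge> 0"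
    and "y \<in> {-1..1}"
  shows "(\<lambda>l. 1 / real l * real (zero_count k (star k \<alpha> l) (star k \<gamma> l) l y)) \<longlonglongrightarrow>
    (2 * a + c + 2) / (2 * pi) *
      (LBINT x:{-1..y}.
        sqrt (4 * mu_ac a c - ((poly (cheb_T k) x)\<^sup>2 - kappa_ac a c)\<^sup>2)
          / (\<bar>poly (cheb_U (k - 1)) x\<bar> * \<bar>poly (cheb_T k) x\<bar> * (1 - x\<^sup>2))
        * indicator (closure (E_set k (kappa_ac a c) (mu_ac a c))) x)"
proof -
  define M where "M = (\<lambda>n::nat. if even n then n else n + 1)"
  have "(\<lambda>n. real (M n) / real n) \<longlonglongrightarrow> 1"
  proof (rule tendsto_sandwich[of "\<lambda>n. 1" _ _ "\<lambda>n. 1 + 1 / real n"])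
    show "\<forall>\<^sub>F n in sequentially. 1 \<le> real (M n) / real n"
      using eventually_gt_at_top[of 0] by eventually_elim (auto simp: M_def)
    show "\<forall>\<^sub>F n in sequentially. real (M n) / real n \<le> 1 + 1 / real n"
      using eventually_gt_at_top[of 0] by eventually_elim (auto simp: M_def field_simps)
    show "(\<lambda>n. 1 + 1 / real n) \<longlonglongrightarrow> 1" using tendsto_add[OF tendsto_const lim_1_over_n, of 1] by simp
  qed simp
  then interpret sieved_zeros k \<alpha> \<gamma> M a c
    by unfold_locales (use assms in \<open>auto simp: M_def\<close>)
  \<comment> \<open>All degrees \<open>l\<close> with \<open>n * k < l \<le> n * k + k\<close> share
    the parameters of index \<open>n\<close>. Both multiples of \<open>k\<close> bounding this range
    are within \<open>k\<close> of \<open>l\<close>, and \<open>M n * k\<close> is the one with even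
    multiplier.\<close>
  define n where "n = (\<lambda>l. (l - 1) div k)"
  define L where "L = (\<lambda>n. real (zero_count k (\<alpha> n) (\<gamma> n) (M n * k) y))"
  define N where "N = (\<lambda>l. real (zero_count k (star k \<alpha> l) (star k \<gamma> l) l y))"
  define J where "J = integral {arccos y..pi} density"
  have L: "(\<lambda>n. L n / real n) \<longlonglongrightarrow> J"
    unfolding L_def J_def zero_count_eq_card_zeros[OF assms(8)]
    using assms(8) by (intro tendsto_zeros arccos_lbound arccos_ubound) auto
  have n: "n l * k < l" "l \<le> n l * k + k" if "l \<ge> 1" for l
  proof -
    have "l - 1 = n l * k + (l - 1) mod k" by (simp add: n_def)
    moreover have "(l - 1) mod k < k" using assms(1) by simp
    ultimately show "n l * k < l" "l \<le> n l * k + k" using that by linarith+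
  qed
  have NL: "\<bar>N l - L (n l)\<bar> \<le> real k" if l: "l \<ge> 1" for l
  proof -
    have N: "N l = real (zero_count k (\<alpha> (n l)) (\<gamma> (n l)) l y)" by (simp add: N_def star_def n_def)
    consider "M (n l) = n l" | "M (n l) = n l + 1"
      unfolding M_def by presburger
    then show ?thesis
    proof cases
      case 1
      then have "l = M (n l) * k + (l - n l * k)" "l - n l * k \<le> k" using n[OF l] by auto
      then show ?thesis
        using zero_count_diff[OF k \<alpha>[of "n l"] \<gamma>[of "n l"], of "M (n l) * k" "l - n l * k" y]
        unfolding N L_def by simp
    next
      case 2
      then have "M (n l) * k = l + (n l * k + k - l)" "n l * k + k - l \<le> k" using n[OF l] by auto
      then show ?thesis
        using zero_count_diff[OF k \<alpha>[of "n l"] \<gamma>[of "n l"], of l "n l * k + k - l" y]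
        unfolding N L_def by (simp add: abs_minus_commute)
    qed
  qed
  have n_top: "filterlim n at_top sequentially"
    unfolding filterlim_at_top
  proof
    fix Z
    show "\<forall>\<^sub>F l in sequentially. Z \<le> n l"
      using eventually_ge_at_top[of "Z * k + 1"]
    proof eventually_elim
      case (elim l)
      then have "Z * k div k \<le> (l - 1) div k" by (intro div_le_mono) simp
      then show ?case using k by (simp add: n_def)
    qed
  qed
  have n_lim: "(\<lambda>l. real (n l) / real l) \<longlonglongrightarrow> 1 / real k"
  proof (rule LIM_zero_cancel, rule tendsto_rabs_zero_cancel, rule tendsto_sandwich[OF _ _ tendsto_const lim_1_over_n])
    show "\<forall>\<^sub>F l in sequentially. \<bar>real (n l) / real l - 1 / real k\<bar> \<le> 1 / real l"
      using eventually_ge_at_top[of 1]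
    proof eventually_elim
      case (elim l)
      have "real (n l * k) \<le> real l" "real l \<le> real (n l * k + k)" using n[OF elim] by linarith+
      then have "\<bar>real (n l) * real k - real l\<bar> \<le> real k" by simp
      moreover have "real (n l) / real l - 1 / real k = (real (n l) * real k - real l) / (real l * real k)"
        using elim k by (simp add: field_simps)
      ultimately show ?case using elim k by (simp add: abs_mult divide_simps)
    qed
  qed simp
  have "(\<lambda>l. (N l - L (n l)) / real l) \<longlonglongrightarrow> 0"
  proof (rule tendsto_rabs_zero_cancel, rule tendsto_sandwich[OF _ _ tendsto_const lim_const_over_n[of "real k"]])
    show "\<forall>\<^sub>F l in sequentially. \<bar>(N l - L (n l)) / real l\<bar> \<le> real k / real l"
      using eventually_ge_at_top[of 1]
      by eventually_elim (use NL in \<open>simp add: divide_right_mono\<close>)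
  qed simp
  \<comment> \<open>The scaled count is \<open>(L / n) * (n / l) + (N - L) / l\<close>, where
    \<open>n / l\<close> supplies the factor \<open>1 / k\<close> and the last term is at most
    \<open>k / l\<close> in size.\<close>
  from tendsto_add[OF tendsto_mult[OF filterlim_compose[OF L n_top] n_lim] this]
  have "(\<lambda>l. L (n l) / real (n l) * (real (n l) / real l) + (N l - L (n l)) / real l) \<longlonglongrightarrow> J * (1 / real k) + 0" .
  moreover have "\<forall>\<^sub>F l in sequentially. L (n l) / real (n l) * (real (n l) / real l) + (N l - L (n l)) / real l = 1 / real l * N l"
    using n_top[unfolded filterlim_at_top, THEN spec, of 1]
    by eventually_elim (simp add: diff_divide_distrib)
  ultimately have "(\<lambda>l. 1 / real l * N l) \<longlonglongrightarrow> J * (1 / real k) + 0"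
    by (rule Lim_transform_eventually)
  then show ?thesis
    unfolding integral_density[OF assms(5,7,8)] N_def J_def by simp
qed

end
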